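(* Let $ic_r(n,k)$ be the number of $k$-compositions of $n$ with exactly $r$ inversions and let $ic_r(n)$ be the number of compositions of $n$ (into any number of parts) with exactly $r$ inversions. Let $$IC_q(p,k)=\sum_{n\geq 0}\sum_{r\geq 0}ic_r(n,k)p^nq^r,\qquad IC_q(p)=\sum_{n\geq 0}\sum_{r\geq 0}ic_r(n)p^nq^r.$$ Then, for every integer $k\ge 0$, $$IC_q(p,k)=\frac{p^k}{(p)_k}\sum_{\lambda\vdash k}f^{\lambda}(p)f^{\lambda}(q),$$ and $$IC_q(p)=\sum_{\mu}\frac{p^{|\mu|}}{(p)_{|\mu|}}f^{\mu}(p)f^{\mu}(q),$$ where $\mu$ runs through all integer partitions (including the empty one). Additionally, $IC_q(p,0)=1$ and, for every $k\ge 1$, $$IC_q(p,k)=\frac{p^k}{1-p^k}\sum_{j=0}^{k-1}\begin{bmatrix}k\\ j\end{bmatrix}_q IC_q(p,j).$$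
   Context: All identities are between formal power series in $p$ with coefficients in $\mathbb{Z}[q]$. A $k$-composition of $n$ is an ordered $k$-tuple $(\sigma_1,\ldots,\sigma_k)$ of positive integers with sum $n$; the empty tuple is the unique $0$-composition, and it is a composition of $0$. An inversion of $\sigma$ is a pair $(i,j)$ with $i<j$ and $\sigma_i>\sigma_j$. A partition $\lambda$ of $n$ (written $\lambda\vdash n$, $|\lambda|=n$) is a weakly decreasing tuple $(\lambda_1,\lambda_2,\ldots)$ of positive integers with sum $n$; the empty partition is the only partition of $0$. $\lambda$ is identified with the set of cells $(i,j)$, $1\le j\le\lambda_i$, of its Young diagram. The hook length $h(u)$ of a cell $u=(i,j)\in\lambda$ is the number of cells to the right of $u$ in the same row plus the number of cells below $u$ in the same column, plus $1$ (for $u$ itself). Notation: $[n]_q=1+q+\cdots+q^{n-1}$; $[n]_q!=[n]_q[n-1]_q\cdots[1]_q$, $[0]_q!=1$; $(q)_n=(1-q)(1-q^2)\cdots(1-q^n)$, $(q)_0=1$; $\begin{bmatrix}n\\ k\end{bmatrix}_q=\frac{(q)_n}{(q)_k(q)_{n-k}}$ is the Gaussian binomial coefficient; and $$f^\lambda(q)=\frac{q^{b(\lambda)}[n]_q!}{\prod_{u\in\lambda}[h(u)]_q},\qquad n=|\lambda|,\quad b(\lambda)=\sum_i (i-1)\lambda_i,$$ which is a polynomial in $q$ (equal to $1$ for the empty partition). The same notations with $p$ in place of $q$ are obtained by substitution. *)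

theory Defs
  imports
    "HOL-Analysis.Infinite_Sum"
    "HOL-Computational_Algebra.Computational_Algebra"
    "HOL-Library.Groups_Big_Fun"
begin

subsection \<open>Compositions and inversions\<close>

definition is_composition :: "nat \<Rightarrow> nat list \<Rightarrow> bool" where
  "is_composition n \<sigma> \<longleftrightarrow> (\<forall>x\<in>set \<sigma>. 0 < x) \<and> sum_list \<sigma> = n"

definition inversions :: "nat list \<Rightarrow> nat" where
  "inversions \<sigma> = card {(i, j). i < j \<and> j < length \<sigma> \<and> \<sigma> ! i > \<sigma> ! j}"

definition ic_parts :: "nat \<Rightarrow> nat \<Rightarrow> nat \<Rightarrow> nat" where
  "ic_parts r n k = card {\<sigma>. is_composition n \<sigma> \<and> length \<sigma> = k \<and> inversions \<sigma> = r}"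

definition ic :: "nat \<Rightarrow> nat \<Rightarrow> nat" where
  "ic r n = card {\<sigma>. is_composition n \<sigma> \<and> inversions \<sigma> = r}"

text \<open>
  The ring of power series in \<open>p\<close> over \<open>\<int>[q]\<close> is \<^typ>\<open>int poly fps\<close>: the variable \<open>q\<close> is
  \<open>[:0, 1:]\<close> and \<open>p\<close> is \<^const>\<open>fps_X\<close>. For fixed \<open>n\<close> only finitely many \<open>r\<close> contribute to the
  coefficient of \<open>p^n\<close>, so that \<^const>\<open>Sum_any\<close> is the sum over all \<open>r\<close>
  (see \<open>coeff_IC_parts\<close> and \<open>coeff_IC\<close>).
\<close>

abbreviation qvar :: "int poly" where
  "qvar \<equiv> [:0, 1:]"

definition IC_parts :: "nat \<Rightarrow> int poly fps" where
  "IC_parts k = Abs_fps (\<lambda>n. Sum_any (\<lambda>r. of_nat (ic_parts r n k) * qvar ^ r))"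

definition IC :: "int poly fps" where
  "IC = Abs_fps (\<lambda>n. Sum_any (\<lambda>r. of_nat (ic r n) * qvar ^ r))"

subsection \<open>Partitions and hook lengths\<close>

definition is_partition :: "nat list \<Rightarrow> bool" where
  "is_partition \<mu> \<longleftrightarrow> sorted_wrt (\<ge>) \<mu> \<and> (\<forall>x\<in>set \<mu>. 0 < x)"

text \<open>Rows, columns and the index in \<open>b_stat\<close> are counted from \<open>0\<close>.\<close>

definition cells :: "nat list \<Rightarrow> (nat \<times> nat) set" where
  "cells \<mu> = {(i, j). i < length \<mu> \<and> j < \<mu> ! i}"

fun hook_length :: "nat list \<Rightarrow> nat \<times> nat \<Rightarrow> nat" where
  "hook_length \<mu> (i, j) =
     card {j'. j < j' \<and> (i, j') \<in> cells \<mu>} + card {i'. i < i' \<and> (i', j) \<in> cells \<mu>} + 1"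

definition b_stat :: "nat list \<Rightarrow> nat" where
  "b_stat \<mu> = (\<Sum>i<length \<mu>. i * \<mu> ! i)"

subsection \<open>\<open>q\<close>-analogues\<close>

definition qint :: "'a::comm_ring_1 \<Rightarrow> nat \<Rightarrow> 'a" where
  "qint x n = (\<Sum>i<n. x ^ i)"

definition qfact :: "'a::comm_ring_1 \<Rightarrow> nat \<Rightarrow> 'a" where
  "qfact x n = (\<Prod>i=1..n. qint x i)"

definition qpoch :: "'a::comm_ring_1 \<Rightarrow> nat \<Rightarrow> 'a" where
  "qpoch x n = (\<Prod>i=1..n. 1 - x ^ i)"

text \<open>
  The Gaussian binomial coefficient (for \<open>k \<le> n\<close>) and \<open>f\<^sup>\<lambda>(q)\<close> are quotients that are
  polynomials in \<open>q\<close>; the exact division \<open>div\<close> on \<^typ>\<open>int poly\<close> yields that polynomial.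
\<close>

definition gauss_binomial :: "nat \<Rightarrow> nat \<Rightarrow> int poly" where
  "gauss_binomial n k = qpoch qvar n div (qpoch qvar k * qpoch qvar (n - k))"

definition f_poly :: "nat list \<Rightarrow> int poly" where
  "f_poly \<mu> = (qvar ^ b_stat \<mu> * qfact qvar (sum_list \<mu>)) div
               (\<Prod>u\<in>cells \<mu>. qint qvar (hook_length \<mu> u))"

definition f_q :: "nat list \<Rightarrow> int poly fps" where
  "f_q \<mu> = fps_const (f_poly \<mu>)"

definition f_p :: "nat list \<Rightarrow> int poly fps" where
  "f_p \<mu> = poly (map_poly of_int (f_poly \<mu>)) fps_X"

text \<open>
  There is no \<^class>\<open>inverse\<close> structure on \<^typ>\<open>int poly\<close>, hence no division on
  \<^typ>\<open>int poly fps\<close>; the following is the inverse of a series with constant term \<open>1\<close>.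
\<close>

definition recip :: "'a::comm_ring_1 fps \<Rightarrow> 'a fps" where
  "recip F = fps_left_inverse F 1"

lemma recip_mult: "fps_nth F 0 = 1 \<Longrightarrow> recip F * F = 1"
  unfolding recip_def by (rule fps_left_inverse) simp

lemma recip_qpoch: "recip (qpoch fps_X k) * qpoch fps_X k = (1 :: 'a::comm_ring_1 fps)"
proof (rule recip_mult)
  show "fps_nth (qpoch fps_X k :: 'a fps) 0 = 1"
    unfolding qpoch_def by (induction k) (simp_all add: fps_mult_nth_0 power_0_left)
qed

subsection \<open>Finiteness\<close>

lemma length_le_sum_list:
  fixes \<sigma> :: "nat list"
  shows "\<forall>x\<in>set \<sigma>. 0 < x \<Longrightarrow> length \<sigma> \<le> sum_list \<sigma>"
  by (induction \<sigma>) auto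

lemma finite_compositions: "finite {\<sigma>. is_composition n \<sigma>}"
proof (rule finite_subset)
  show "{\<sigma>. is_composition n \<sigma>} \<subseteq> {\<sigma>. set \<sigma> \<subseteq> {..n} \<and> length \<sigma> \<le> n}"
    using length_le_sum_list member_le_sum_list by (fastforce simp: is_composition_def)
qed (simp add: finite_lists_length_le)

lemma finite_partitions: "finite {\<mu>. is_partition \<mu> \<and> sum_list \<mu> = n}"
  by (rule finite_subset[OF _ finite_compositions[of n]])
     (auto simp: is_partition_def is_composition_def)

lemma finite_cells: "finite (cells \<mu>)"
  by (rule finite_subset[of _ "Sigma {..<length \<mu>} (\<lambda>i. {..<\<mu> ! i})"]) (auto simp: cells_def)

lemma coeff_Sum_any_qvar:
  assumes "finite {r. c r \<noteq> (0::nat)}"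
  shows "coeff (Sum_any (\<lambda>r. of_nat (c r) * qvar ^ r)) r = int (c r)"
proof -
  have eq: "of_nat m * qvar ^ s = monom (int m) s" for m s
    by (simp add: monom_altdef of_nat_poly)
  have "Sum_any (\<lambda>r. of_nat (c r) * qvar ^ r) = (\<Sum>s\<in>{r. c r \<noteq> 0}. monom (int (c s)) s)"
    unfolding eq by (rule Sum_any.expand_superset) (use assms in auto)
  then show ?thesis
    using assms by (simp add: coeff_sum)
qed

lemma finite_inversion_support:
  assumes "finite S"
  shows "finite {r. card {\<sigma> \<in> S. inversions \<sigma> = r} \<noteq> 0}"
proof (rule finite_subset)
  show "{r. card {\<sigma> \<in> S. inversions \<sigma> = r} \<noteq> 0} \<subseteq> inversions ` S"
  proof
    fix r assume "r \<in> {r. card {\<sigma> \<in> S. inversions \<sigma> = r} \<noteq> 0}"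
    then have "{\<sigma> \<in> S. inversions \<sigma> = r} \<noteq> {}"
      by force
    then show "r \<in> inversions ` S"
      by auto
  qed
qed (use assms in simp)

lemma coeff_IC_parts: "coeff (fps_nth (IC_parts k) n) r = int (ic_parts r n k)"
proof -
  have "finite {r. ic_parts r n k \<noteq> 0}"
    using finite_inversion_support[of "{\<sigma>. is_composition n \<sigma> \<and> length \<sigma> = k}"]
      finite_compositions[of n] by (simp add: ic_parts_def conj_assoc)
  then show ?thesis
    by (simp add: IC_parts_def coeff_Sum_any_qvar)
qed

lemma coeff_IC: "coeff (fps_nth IC n) r = int (ic r n)"
proof -
  have "finite {r. ic r n \<noteq> 0}"
    using finite_inversion_support[OF finite_compositions[of n]] by (simp add: ic_def)
  then show ?thesis
    by (simp add: IC_def coeff_Sum_any_qvar)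
qed

end

theory Submission
  imports Defs "Jordan_Normal_Form.Char_Poly"
begin

text \<open>
  Subtracting \<open>1\<close> from every part of a composition leaves zeros, whose positions account for a Gaussian
  binomial coefficient, interleaved with a shorter composition. This gives the recursion for
  \<open>IC\<^sub>q(p, k)\<close>, which determines these series.

  Up to the factor \<open>(q)\<^sub>n\<close>, \<open>f\<^sup>\<lambda>(q)\<close> is the principal specialization
  \<open>S\<^sub>\<lambda>(q) = s\<^sub>\<lambda>(1, q, q\<^sup>2, \<dots>)\<close> of a Schur function, and the recursion
  becomes \<open>H\<^sub>n = \<Sum>\<^sub>j p\<^sup>j H\<^sub>j / (q)\<^bsub>n-j\<^esub>\<close> for
  \<open>H\<^sub>n = \<Sum>\<^bsub>\<lambda> \<turnstile> n\<^esub> S\<^sub>\<lambda>(p) S\<^sub>\<lambda>(q)\<close>. It follows from two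
  facts about horizontal strips \<open>\<lambda>/\<kappa>\<close>: the branching rule
  \<open>S\<^sub>\<lambda> = \<Sum>\<^sub>\<kappa> q\<^bsup>|\<kappa>|\<^esup> S\<^sub>\<kappa>\<close>, which is a telescoping
  sum in the rows of the determinant of the \<open>1/(q)\<^bsub>\<lambda>(i)+N-1-i-c\<^esub>\<close>, and the Pieri rule
  \<open>S\<^sub>\<kappa>/(q)\<^sub>r = \<Sum>\<^sub>\<lambda> S\<^sub>\<lambda>\<close>, which is deduced from the branching rule by
  commuting the addition and the removal of horizontal strips. The branching rule also shows
  inductively that \<open>f\<^sup>\<lambda>(q)\<close> is a polynomial.
\<close>

subsection \<open>Gaussian binomial coefficients\<close>

lemma qpoch_0 [simp]: "qpoch x 0 = 1"
  by (simp add: qpoch_def)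

lemma qpoch_Suc: "qpoch x (Suc n) = qpoch x n * (1 - x ^ Suc n)"
  by (simp add: qpoch_def)

lemma qpoch_nonzero:
  fixes x :: "'a::idom"
  assumes "\<And>n. 0 < n \<Longrightarrow> x ^ n \<noteq> 1"
  shows "qpoch x n \<noteq> 0"
  using assms by (auto simp: qpoch_def)

lemma qvar_power: "qvar ^ n = monom 1 n"
  by (simp add: monom_altdef)

lemma qvar_power_neq_1: "0 < n \<Longrightarrow> qvar ^ n \<noteq> 1"
  by (simp add: qvar_power monom_eq_1_iff)

text \<open>This form of Pascal's rule makes sense in every commutative ring. Its two terms match
  the words with a zero and with a positive first letter in
  \<open>sum_inversions_insert_zeros\<close>.\<close>

fun gbin :: "'a::comm_ring_1 \<Rightarrow> nat \<Rightarrow> nat \<Rightarrow> 'a" where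
  "gbin x n 0 = 1"
| "gbin x 0 (Suc k) = 0"
| "gbin x (Suc n) (Suc k) = gbin x n (Suc k) + x ^ (n - k) * gbin x n k"

lemma gbin_eq_0: "n < k \<Longrightarrow> gbin x n k = 0"
  by (induction x n k rule: gbin.induct) auto

lemma gbin_self [simp]: "gbin x n n = 1"
  by (induction n) (auto simp: gbin_eq_0)

text \<open>For \<open>n = Suc k + m\<close> the two terms of Pascal's rule contribute
  \<open>qpoch x n\<close> times \<open>1 - x ^ Suc m\<close> and times
  \<open>x ^ Suc m * (1 - x ^ Suc k)\<close>; these factors add up to
  \<open>1 - x ^ Suc n\<close>.\<close>

lemma gbin_qpoch: "k \<le> n \<Longrightarrow> gbin x n k * (qpoch x k * qpoch x (n - k)) = qpoch x n"
proof (induction x n k rule: gbin.induct)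
  case (3 x n k)
  show ?case
  proof (cases "k = n")
    case True
    then show ?thesis by (simp add: gbin_eq_0)
  next
    case False
    with 3 have "Suc k \<le> n" by simp
    define m where "m = n - Suc k"
    have n: "n = Suc k + m" using \<open>Suc k \<le> n\<close> by (simp add: m_def)
    have 1: "gbin x n (Suc k) * (qpoch x (Suc k) * qpoch x m) = qpoch x n"
      using 3(1)[OF \<open>Suc k \<le> n\<close>] by (simp add: m_def)
    have 2: "gbin x n k * (qpoch x k * qpoch x (Suc m)) = qpoch x n"
      using 3(2) \<open>Suc k \<le> n\<close> by (simp add: n)
    have "gbin x (Suc n) (Suc k) * (qpoch x (Suc k) * qpoch x (Suc n - Suc k))
      = gbin x n (Suc k) * (qpoch x (Suc k) * qpoch x m) * (1 - x ^ Suc m)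
        + x ^ Suc m * (1 - x ^ Suc k) * (gbin x n k * (qpoch x k * qpoch x (Suc m)))"
      by (simp add: n qpoch_Suc algebra_simps)
    also have "\<dots> = qpoch x n * (1 - x ^ Suc n)"
      unfolding 1 2 by (simp add: n algebra_simps power_add)
    finally show ?thesis by (simp add: qpoch_Suc)
  qed
qed auto

lemma gauss_binomial_eq_gbin: "k \<le> n \<Longrightarrow> gauss_binomial n k = gbin qvar n k"
  unfolding gauss_binomial_def
  by (subst gbin_qpoch[of k n, symmetric])
     (auto simp: qpoch_nonzero qvar_power_neq_1)

subsection \<open>The recursion for compositions\<close>

lemma inversions_Nil [simp]: "inversions [] = 0"
  by (simp add: inversions_def)

lemma inversions_Cons: "inversions (x # xs) = inversions xs + length (filter (\<lambda>y. y < x) xs)"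
proof -
  have "{(i, j). i < j \<and> j < length (x # xs) \<and> (x # xs) ! i > (x # xs) ! j}
    = map_prod Suc Suc ` {(i, j). i < j \<and> j < length xs \<and> xs ! i > xs ! j}
      \<union> (\<lambda>j. (0, Suc j)) ` {j. j < length xs \<and> xs ! j < x}" (is "?L = ?A \<union> ?B")
  proof (intro equalityI subsetI)
    fix z assume "z \<in> ?L"
    then obtain i j where z: "z = (i, j)" "i < j" "j < length (x # xs)" "(x # xs) ! i > (x # xs) ! j"
      by auto
    then obtain j' where j: "j = Suc j'" by (cases j) auto
    show "z \<in> ?A \<union> ?B"
      using z j by (cases i) (auto simp: map_prod_def image_iff)
  qed auto
  moreover have "finite {(i, j). i < j \<and> j < length xs \<and> xs ! i > xs ! j}"
    by (rule finite_subset[of _ "{..<length xs} \<times> {..<length xs}"]) auto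
  moreover have "?A \<inter> ?B = {}" by auto
  ultimately have "inversions (x # xs) = card {(i, j). i < j \<and> j < length xs \<and> xs ! i > xs ! j}
      + card {j. j < length xs \<and> xs ! j < x}"
    unfolding inversions_def
    by (simp add: card_Un_disjoint card_image inj_on_def prod.inj_map)
  then show ?thesis
    by (simp add: inversions_def length_filter_conv_card)
qed

lemma inversions_map_Suc [simp]: "inversions (map Suc xs) = inversions xs"
  by (induction xs) (simp_all add: inversions_Cons filter_map o_def)

text \<open>A leading zero creates no inversion, while a leading letter \<open>a\<close> exceeds the
  \<open>k - length \<rho>'\<close> zeros behind it and the smaller letters of
  \<open>\<rho>'\<close>. Splitting by the first letter therefore reproduces the recursion of
  \<open>gbin\<close>.\<close>

lemma sum_inversions_insert_zeros:
  fixes x :: "'a::comm_ring_1"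
  assumes "\<forall>y\<in>set \<rho>. 0 < y"
  shows "(\<Sum>\<tau> | length \<tau> = k \<and> filter ((<) 0) \<tau> = \<rho>. x ^ inversions \<tau>)
    = gbin x k (length \<rho>) * x ^ inversions \<rho>"
  using assms
proof (induction k arbitrary: \<rho>)
  case 0
  have "{\<tau>. length \<tau> = 0 \<and> filter ((<) 0) \<tau> = \<rho>} = (if \<rho> = [] then {[]} else {})"
    by auto
  then show ?case
    by (simp only:) (cases \<rho>; simp)
next
  case (Suc k)
  define T where "T = (\<lambda>k \<rho>. {\<tau>::nat list. length \<tau> = k \<and> filter ((<) 0) \<tau> = \<rho>})"
  have fin: "finite (T k \<rho>)" for k \<rho>
  proof (rule finite_subset)
    show "T k \<rho> \<subseteq> {\<tau>. set \<tau> \<subseteq> insert 0 (set \<rho>) \<and> length \<tau> = k}"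
      by (auto simp: T_def)
  qed (auto intro: finite_lists_length_eq)
  have zero: "(\<Sum>\<tau>\<in>(#) 0 ` T k \<rho>. x ^ inversions \<tau>) = gbin x k (length \<rho>) * x ^ inversions \<rho>"
    using Suc by (subst sum.reindex) (auto simp: T_def inversions_Cons)
  show ?case
  proof (cases \<rho>)
    case Nil
    have "T (Suc k) \<rho> = (#) 0 ` T k \<rho>"
      using Nil by (auto simp: T_def length_Suc_conv image_iff filter_empty_conv)
    then show ?thesis
      using zero Nil by (simp add: T_def)
  next
    case (Cons a \<rho>')
    have len: "length \<rho> = Suc (length \<rho>')" using Cons by simp
    have a: "0 < a" and \<rho>': "\<forall>y\<in>set \<rho>'. 0 < y" using Suc.prems Cons by auto
    have split: "T (Suc k) \<rho> = (#) 0 ` T k \<rho> \<union> (#) a ` T k \<rho>'"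
      using Cons a by (auto simp: T_def length_Suc_conv image_iff split: if_splits)
    have inv: "inversions (a # \<tau>) = inversions \<tau> + (k - length \<rho>') + length (filter (\<lambda>y. y < a) \<rho>')"
      if "\<tau> \<in> T k \<rho>'" for \<tau>
    proof -
      have *: "length (filter ((<) 0) xs) + length (filter (\<lambda>y. y < a) xs)
        = length xs + length (filter (\<lambda>y. y < a) (filter ((<) 0) xs))" for xs
        using a by (induction xs) auto
      show ?thesis
        using that *[of \<tau>] length_filter_le[of "(<) 0" \<tau>] by (auto simp: T_def inversions_Cons)
    qed
    have "(\<Sum>\<tau>\<in>(#) a ` T k \<rho>'. x ^ inversions \<tau>)
      = (\<Sum>\<tau>\<in>T k \<rho>'. x ^ (k - length \<rho>') * x ^ length (filter (\<lambda>y. y < a) \<rho>') * x ^ inversions \<tau>)"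
      by (subst sum.reindex) (auto simp: inv power_add intro!: sum.cong)
    also have "\<dots> = x ^ (k - length \<rho>') * x ^ length (filter (\<lambda>y. y < a) \<rho>')
        * (gbin x k (length \<rho>') * x ^ inversions \<rho>')"
      using Suc.IH[OF \<rho>'] by (simp add: T_def flip: sum_distrib_left)
    also have "\<dots> = x ^ (k - length \<rho>') * gbin x k (length \<rho>') * x ^ inversions \<rho>"
      by (simp add: Cons inversions_Cons power_add)
    finally have pos: "(\<Sum>\<tau>\<in>(#) a ` T k \<rho>'. x ^ inversions \<tau>) = \<dots>" .
    have "(\<Sum>\<tau>\<in>T (Suc k) \<rho>. x ^ inversions \<tau>) = gbin x (Suc k) (length \<rho>) * x ^ inversions \<rho>"
      unfolding split using a
      by (subst sum.union_disjoint) (auto simp: fin zero pos len algebra_simps)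
    then show ?thesis by (simp add: T_def)
  qed
qed

section \<open>Generating series of compositions by inversions\<close>

lemma fps_nth_IC_parts:
  "fps_nth (IC_parts k) n = (\<Sum>\<sigma> | is_composition n \<sigma> \<and> length \<sigma> = k. qvar ^ inversions \<sigma>)"
proof (rule poly_eqI)
  fix r
  have "finite {\<sigma>. is_composition n \<sigma> \<and> length \<sigma> = k}"
    by (rule finite_subset[OF _ finite_compositions[of n]]) auto
  then show "coeff (fps_nth (IC_parts k) n) r
    = coeff (\<Sum>\<sigma> | is_composition n \<sigma> \<and> length \<sigma> = k. qvar ^ inversions \<sigma>) r"
    by (simp add: coeff_IC_parts ic_parts_def coeff_sum qvar_power sum.If_cases Int_def conj_assoc)
qed

lemma fps_nth_IC: "fps_nth IC n = (\<Sum>k\<le>n. fps_nth (IC_parts k) n)"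
proof -
  have fin: "finite {\<sigma>. is_composition n \<sigma>}" by (rule finite_compositions)
  have "fps_nth IC n = (\<Sum>\<sigma> | is_composition n \<sigma>. qvar ^ inversions \<sigma>)"
    by (rule poly_eqI) (use fin in \<open>simp add: coeff_IC ic_def coeff_sum qvar_power sum.If_cases Int_def\<close>)
  also have "\<dots> = (\<Sum>k\<le>n. \<Sum>\<sigma> | \<sigma> \<in> {\<sigma>. is_composition n \<sigma>} \<and> length \<sigma> = k. qvar ^ inversions \<sigma>)"
    by (rule sum.group[symmetric]) (use fin length_le_sum_list in \<open>auto simp: is_composition_def\<close>)
  finally show ?thesis by (simp add: fps_nth_IC_parts)
qed

lemma IC_parts_nth_eq_0: "n < k \<Longrightarrow> fps_nth (IC_parts k) n = 0"
  unfolding fps_nth_IC_parts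
  by (rule sum.neutral) (use length_le_sum_list in \<open>force simp: is_composition_def\<close>)

lemma sum_list_map_Suc: "sum_list (map Suc xs) = sum_list xs + length xs"
  by (induction xs) auto

lemma bij_betw_map_Suc_compositions:
  "bij_betw (map Suc) {\<tau>. length \<tau> = k \<and> sum_list \<tau> = n}
     {\<sigma>. is_composition (n + k) \<sigma> \<and> length \<sigma> = k}"
proof (rule bij_betw_byWitness[of _ "map (\<lambda>x. x - 1)"])
  have inv: "map Suc (map (\<lambda>x. x - 1) \<sigma>) = \<sigma>" if "\<forall>x\<in>set \<sigma>. 0 < x" for \<sigma>
    using that by (induction \<sigma>) auto
  then show "\<forall>\<sigma>\<in>{\<sigma>. is_composition (n + k) \<sigma> \<and> length \<sigma> = k}. map Suc (map (\<lambda>x. x - 1) \<sigma>) = \<sigma>"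
    by (simp add: is_composition_def)
  show "map (\<lambda>x. x - 1) ` {\<sigma>. is_composition (n + k) \<sigma> \<and> length \<sigma> = k}
    \<subseteq> {\<tau>. length \<tau> = k \<and> sum_list \<tau> = n}"
  proof (rule image_subsetI)
    fix \<sigma> assume "\<sigma> \<in> {\<sigma>. is_composition (n + k) \<sigma> \<and> length \<sigma> = k}"
    then show "map (\<lambda>x. x - 1) \<sigma> \<in> {\<tau>. length \<tau> = k \<and> sum_list \<tau> = n}"
      using inv[of \<sigma>] sum_list_map_Suc[of "map (\<lambda>x. x - 1) \<sigma>"] by (simp add: is_composition_def)
  qed
qed (auto simp: is_composition_def sum_list_map_Suc o_def)

text \<open>\<open>map Suc\<close> preserves inversions and accounts for \<open>fps_X ^ k\<close>.
  The words that remain are grouped by the subword \<open>\<rho>\<close> of their positive letters,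
  and \<open>sum_inversions_insert_zeros\<close> sums each fibre.\<close>

lemma IC_parts_unfold:
  "IC_parts k = fps_X ^ k * (\<Sum>j\<le>k. fps_const (gbin qvar k j) * IC_parts j)"
proof (rule fps_ext)
  fix n
  show "fps_nth (IC_parts k) n
    = fps_nth (fps_X ^ k * (\<Sum>j\<le>k. fps_const (gbin qvar k j) * IC_parts j)) n"
  proof (cases "n < k")
    case True
    then show ?thesis
      by (simp add: IC_parts_nth_eq_0 fps_X_power_mult_nth)
  next
    case False
    define m where "m = n - k"
    have n: "n = m + k" using False by (simp add: m_def)
    define W where "W = {\<tau>::nat list. length \<tau> = k \<and> sum_list \<tau> = m}"
    have finW: "finite W"
      by (rule finite_subset[of _ "{\<tau>. set \<tau> \<subseteq> {..m} \<and> length \<tau> = k}"])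
         (auto simp: W_def finite_lists_length_eq member_le_sum_list)
    define C where "C = {\<rho>. is_composition m \<rho>}"
    have finC: "finite C" unfolding C_def by (rule finite_compositions)
    have sum_filter: "sum_list (filter ((<) 0) \<tau>) = sum_list \<tau>" for \<tau> :: "nat list"
      by (induction \<tau>) auto
    have "fps_nth (IC_parts k) n = (\<Sum>\<tau>\<in>W. qvar ^ inversions \<tau>)"
      unfolding fps_nth_IC_parts n W_def
      by (subst sum.reindex_bij_betw[OF bij_betw_map_Suc_compositions, symmetric]) simp
    also have "\<dots> = (\<Sum>\<rho>\<in>C. \<Sum>\<tau> | \<tau> \<in> W \<and> filter ((<) 0) \<tau> = \<rho>. qvar ^ inversions \<tau>)"
      by (rule sum.group[symmetric, OF finW finC])
         (simp add: W_def C_def is_composition_def sum_filter image_subset_iff)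
    also have "\<dots> = (\<Sum>\<rho>\<in>C. gbin qvar k (length \<rho>) * qvar ^ inversions \<rho>)"
    proof (rule sum.cong[OF refl])
      fix \<rho> assume \<rho>: "\<rho> \<in> C"
      then have "{\<tau> \<in> W. filter ((<) 0) \<tau> = \<rho>} = {\<tau>. length \<tau> = k \<and> filter ((<) 0) \<tau> = \<rho>}"
        by (auto simp: C_def W_def is_composition_def sum_filter)
      then show "(\<Sum>\<tau> | \<tau> \<in> W \<and> filter ((<) 0) \<tau> = \<rho>. qvar ^ inversions \<tau>)
        = gbin qvar k (length \<rho>) * qvar ^ inversions \<rho>"
        using \<rho> sum_inversions_insert_zeros[of \<rho> qvar k] by (simp add: C_def is_composition_def)
    qed
    \<comment> \<open>The bound \<open>max m k\<close> covers every length of a composition of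
      \<open>m\<close> as well as the target range \<open>j \<le> k\<close>; the terms with
      \<open>j > k\<close> vanish with \<open>gbin\<close>.\<close>
    also have "\<dots> = (\<Sum>j\<le>max m k. \<Sum>\<rho> | \<rho> \<in> C \<and> length \<rho> = j. gbin qvar k (length \<rho>) * qvar ^ inversions \<rho>)"
      by (rule sum.group[symmetric, OF finC])
         (auto simp: C_def is_composition_def le_max_iff_disj length_le_sum_list)
    also have "\<dots> = (\<Sum>j\<le>max m k. gbin qvar k j * fps_nth (IC_parts j) m)"
      by (auto simp: fps_nth_IC_parts C_def sum_distrib_left intro!: sum.cong)
    also have "\<dots> = (\<Sum>j\<le>k. gbin qvar k j * fps_nth (IC_parts j) m)"
      by (rule sum.mono_neutral_right) (auto simp: gbin_eq_0)
    finally show ?thesis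
      by (simp add: n fps_X_power_mult_nth fps_sum_nth)
  qed
qed

text \<open>The summand \<open>j = k\<close> of \<open>IC_parts_unfold\<close> is
  \<open>IC_parts k\<close> itself, because \<open>gbin x k k = 1\<close>, and moves to the
  left.\<close>

lemma IC_parts_recursion:
  "(1 - fps_X ^ k) * IC_parts k = fps_X ^ k * (\<Sum>j<k. fps_const (gbin qvar k j) * IC_parts j)"
  using IC_parts_unfold[of k]
  by (simp add: lessThan_Suc_atMost[symmetric] algebra_simps)

lemma IC_parts_0: "IC_parts 0 = 1"
proof (rule fps_ext)
  fix n
  have "{\<sigma>. is_composition n \<sigma> \<and> length \<sigma> = 0} = (if n = 0 then {[]} else {})"
    by (auto simp: is_composition_def)
  then show "fps_nth (IC_parts 0) n = fps_nth 1 n"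
    unfolding fps_nth_IC_parts by simp
qed

subsection \<open>Determinants\<close>

definition fdet :: "nat \<Rightarrow> (nat \<Rightarrow> nat \<Rightarrow> 'a::comm_ring_1) \<Rightarrow> 'a" where
  "fdet N f = det (mat N N (\<lambda>(i, c). f i c))"

lemma fdet_leibniz:
  "fdet N f = (\<Sum>\<pi> | \<pi> permutes {0..<N}. signof \<pi> * (\<Prod>i = 0..<N. f i (\<pi> i)))"
  unfolding fdet_def
  by (subst det_def'[of _ N])
     (auto intro!: sum.cong arg_cong2[of _ _ _ _ "(*)"] prod.cong dest: permutes_in_image)

lemma fdet_mult:
  "fdet N (\<lambda>i c. \<Sum>k<N. f i k * g k c) = fdet N f * fdet N g"
  unfolding fdet_def
  by (subst det_mult[symmetric, of _ N])
     (auto intro!: arg_cong[of _ _ det] eq_matI sum.cong simp: scalar_prod_def atLeast0LessThan)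

lemma fdet_cong:
  assumes "\<And>i c. i < N \<Longrightarrow> c < N \<Longrightarrow> f i c = g i c"
  shows "fdet N f = fdet N g"
  unfolding fdet_def by (rule arg_cong[of _ _ det], rule eq_matI) (use assms in auto)

lemma fdet_upper_triangular:
  assumes "\<And>i c. c < i \<Longrightarrow> i < N \<Longrightarrow> f i c = 0"
  shows "fdet N f = (\<Prod>i<N. f i i)"
  unfolding fdet_def
  by (subst det_upper_triangular[of _ N])
     (use assms in \<open>auto simp: prod_list_diag_prod atLeast0LessThan\<close>)

lemma fdet_lower_triangular:
  assumes "\<And>i c. i < c \<Longrightarrow> c < N \<Longrightarrow> f i c = 0"
  shows "fdet N f = (\<Prod>i<N. f i i)"
  unfolding fdet_def
  by (subst det_lower_triangular[of N])
     (use assms in \<open>auto simp: prod_list_diag_prod atLeast0LessThan\<close>)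

text \<open>All rows change at once: the matrix is multiplied from the left by the bidiagonal matrix
  \<open>u\<close>, which is upper triangular with unit diagonal.\<close>

lemma fdet_row_diff:
  "fdet N (\<lambda>i c. f i c - (if Suc i < N then f (Suc i) c else 0)) = fdet N f"
proof -
  define u :: "nat \<Rightarrow> nat \<Rightarrow> 'a" where "u = (\<lambda>i k. if k = i then 1 else if k = Suc i then -1 else 0)"
  have "f i c - (if Suc i < N then f (Suc i) c else 0) = (\<Sum>k<N. u i k * f k c)" if "i < N" for i c
  proof -
    have "(\<Sum>k<N. u i k * f k c) = (\<Sum>k<N. (if k = i then f k c else 0) - (if k = Suc i then f k c else 0))"
      by (rule sum.cong) (auto simp: u_def)
    then show ?thesis
      using that by (simp add: sum_subtractf)
  qed
  then have "fdet N (\<lambda>i c. f i c - (if Suc i < N then f (Suc i) c else 0)) = fdet N u * fdet N f"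
    by (subst fdet_mult[symmetric]) (auto intro!: fdet_cong)
  moreover have "fdet N u = 1"
    by (subst fdet_upper_triangular) (auto simp: u_def)
  ultimately show ?thesis
    by simp
qed

text \<open>The matrix is the product of the Vandermonde matrix and the matrix of coefficients,
  which the degree bound makes upper triangular.\<close>

lemma fdet_poly_monomials:
  fixes p :: "nat \<Rightarrow> 'a::comm_ring_1 poly"
  assumes "\<And>c. c < N \<Longrightarrow> degree (p c) \<le> c"
  shows "fdet N (\<lambda>i c. poly (p c) (y i)) = fdet N (\<lambda>i c. y i ^ c) * (\<Prod>c<N. coeff (p c) c)"
proof -
  have "fdet N (\<lambda>i c. poly (p c) (y i)) = fdet N (\<lambda>i c. \<Sum>k<N. y i ^ k * coeff (p c) k)"
  proof (rule fdet_cong)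
    fix i c assume "c < N"
    then show "poly (p c) (y i) = (\<Sum>k<N. y i ^ k * coeff (p c) k)"
      using assms[of c] unfolding poly_altdef
      by (intro sum.mono_neutral_cong_left) (auto simp: coeff_eq_0 mult.commute)
  qed
  also have "\<dots> = fdet N (\<lambda>i c. y i ^ c) * fdet N (\<lambda>k c. coeff (p c) k)"
    by (rule fdet_mult)
  also have "fdet N (\<lambda>k c. coeff (p c) k) = (\<Prod>c<N. coeff (p c) c)"
    by (rule fdet_upper_triangular) (meson assms coeff_eq_0 le_less_trans order.strict_trans)
  finally show ?thesis .
qed

lemma monic_prod_linear:
  fixes y :: "nat \<Rightarrow> 'a::idom"
  shows "degree (\<Prod>t<c. [:- y t, 1:]) = c \<and> coeff (\<Prod>t<c. [:- y t, 1:]) c = 1"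
proof -
  have "degree (\<Prod>t<c. [:- y t, 1:]) = c"
    by (subst degree_prod_eq_sum_degree) auto
  moreover have "lead_coeff (\<Prod>t<c. [:- y t, 1:]) = 1"
    by (simp add: lead_coeff_prod)
  ultimately show ?thesis
    by simp
qed

text \<open>The Vandermonde matrix becomes triangular in the Newton basis at the points \<open>y i\<close>.\<close>

lemma fdet_poly:
  fixes p :: "nat \<Rightarrow> 'a::idom poly"
  assumes "\<And>c. c < N \<Longrightarrow> degree (p c) \<le> c"
  shows "fdet N (\<lambda>i c. poly (p c) (y i)) = (\<Prod>c<N. coeff (p c) c) * (\<Prod>k<N. \<Prod>i<k. y k - y i)"
proof -
  define w where "w = (\<lambda>c. \<Prod>t<c. [:- y t, 1:])"
  have "fdet N (\<lambda>i c. poly (w c) (y i)) = fdet N (\<lambda>i c. y i ^ c)"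
    using fdet_poly_monomials[of N w y] monic_prod_linear[where y = y] by (simp add: w_def)
  moreover have "fdet N (\<lambda>i c. poly (w c) (y i)) = (\<Prod>i<N. poly (w i) (y i))"
    by (rule fdet_lower_triangular) (auto simp: w_def poly_prod)
  ultimately have "fdet N (\<lambda>i c. y i ^ c) = (\<Prod>k<N. \<Prod>i<k. y k - y i)"
    by (simp add: w_def poly_prod)
  then show ?thesis
    using fdet_poly_monomials[of N p y] assms by (simp add: mult.commute)
qed

lemma fdet_scale_rows: "fdet N (\<lambda>i c. a i * f i c) = (\<Prod>i<N. a i) * fdet N f"
  unfolding fdet_leibniz sum_distrib_left
  by (rule sum.cong) (simp_all add: prod.distrib atLeast0LessThan mult_ac)

lemma fdet_scale_columns: "fdet N (\<lambda>i c. f i c * a c) = fdet N f * (\<Prod>c<N. a c)"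
proof -
  have "(\<Prod>i<N. a (\<pi> i)) = (\<Prod>i<N. a i)" if "\<pi> permutes {..<N}" for \<pi>
    using prod.permute[OF that, of a] by (simp add: o_def)
  then show ?thesis
    unfolding fdet_leibniz sum_distrib_right
    by (intro sum.cong) (simp_all add: prod.distrib atLeast0LessThan mult_ac)
qed

text \<open>Multilinearity in all rows simultaneously; \<open>\<phi>\<close> records the summand
  chosen in each row.\<close>

lemma fdet_sum_rows:
  assumes "\<And>i. i < N \<Longrightarrow> finite (B i)"
  shows "fdet N (\<lambda>i c. \<Sum>m\<in>B i. h i m c) = (\<Sum>\<phi>\<in>PiE {..<N} B. fdet N (\<lambda>i c. h i (\<phi> i) c))"
proof -
  have "fdet N (\<lambda>i c. \<Sum>m\<in>B i. h i m c)
    = (\<Sum>\<pi> | \<pi> permutes {..<N}. signof \<pi> * (\<Sum>\<phi>\<in>PiE {..<N} B. \<Prod>i<N. h i (\<phi> i) (\<pi> i)))"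
    unfolding fdet_leibniz atLeast0LessThan
    by (intro sum.cong refl, subst prod_sum_PiE) (use assms in auto)
  also have "\<dots> = (\<Sum>\<phi>\<in>PiE {..<N} B. fdet N (\<lambda>i c. h i (\<phi> i) c))"
    unfolding fdet_leibniz atLeast0LessThan sum_distrib_left by (rule sum.swap)
  finally show ?thesis .
qed

subsection \<open>Partitions as functions and horizontal strips\<close>

text \<open>
  A partition is the weakly decreasing function of finite support that gives its row lengths, so that
  trailing zeros cause no ambiguity.
\<close>

definition ptns :: "(nat \<Rightarrow> nat) set" where
  "ptns = {l. antimono l \<and> finite {i. l i \<noteq> 0}}"

definition ptn_size :: "(nat \<Rightarrow> nat) \<Rightarrow> nat" where
  "ptn_size l = (\<Sum>i | l i \<noteq> 0. l i)"

definition ptns_of :: "nat \<Rightarrow> (nat \<Rightarrow> nat) set" where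
  "ptns_of n = {l \<in> ptns. ptn_size l = n}"

text \<open>The interlacing inequalities say that the skew shape \<open>l/k\<close> has at most one
  cell in each column.\<close>

definition hstrips_below :: "(nat \<Rightarrow> nat) \<Rightarrow> (nat \<Rightarrow> nat) set" where
  "hstrips_below l = {k. \<forall>i. l (Suc i) \<le> k i \<and> k i \<le> l i}"

text \<open>The number \<open>r\<close> of added cells is fixed because interlacing puts no upper
  bound on the first row of \<open>l\<close>.\<close>

definition hstrips_above :: "nat \<Rightarrow> (nat \<Rightarrow> nat) \<Rightarrow> (nat \<Rightarrow> nat) set" where
  "hstrips_above r k = {l. k \<in> hstrips_below l \<and> ptn_size l = ptn_size k + r}"

section \<open>Sizes of partitions, and finiteness of the sets of strips\<close>

lemma ptns_mono: "l \<in> ptns \<Longrightarrow> i \<le> j \<Longrightarrow> l j \<le> l i"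
  by (auto simp: ptns_def antimono_def)

lemma ptn_size_eq_sum: "(\<And>i. N \<le> i \<Longrightarrow> l i = 0) \<Longrightarrow> ptn_size l = (\<Sum>i<N. l i)"
  unfolding ptn_size_def by (rule sum.mono_neutral_left) (auto, metis leI less_irrefl)

text \<open>If row \<open>i\<close> is nonempty, each of the rows \<open>0\<close> to
  \<open>i\<close> has a cell. The size thus bounds the number of rows.\<close>

lemma ptns_zero_beyond:
  assumes "l \<in> ptns" "ptn_size l \<le> i"
  shows "l i = 0"
proof (rule ccontr)
  assume "l i \<noteq> 0"
  then have pos: "1 \<le> l j" if "j \<le> i" for j
    using ptns_mono[OF assms(1) that] by simp
  have "Suc i = (\<Sum>j\<le>i. 1)" by simp
  also have "\<dots> \<le> (\<Sum>j\<le>i. l j)" by (rule sum_mono) (use pos in auto)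
  also have "\<dots> \<le> ptn_size l"
    unfolding ptn_size_def by (rule sum_mono2) (use assms pos in \<open>force simp: ptns_def\<close>)+
  finally show False using assms(2) by simp
qed

lemma ptns_le_ptn_size:
  assumes "l \<in> ptns"
  shows "l i \<le> ptn_size l"
proof (cases "l i = 0")
  case False
  then show ?thesis
    unfolding ptn_size_def by (intro member_le_sum) (use assms in \<open>auto simp: ptns_def\<close>)
qed simp

lemma finite_ptns_of: "finite (ptns_of n)"
proof (rule finite_subset)
  show "ptns_of n \<subseteq> {l. \<forall>i. (i \<in> {..<n} \<longrightarrow> l i \<in> {..n}) \<and> (i \<notin> {..<n} \<longrightarrow> l i = 0)}"
  proof
    fix l assume "l \<in> ptns_of n"
    then have "l \<in> ptns" "ptn_size l = n" by (auto simp: ptns_of_def)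
    then show "l \<in> {l. \<forall>i. (i \<in> {..<n} \<longrightarrow> l i \<in> {..n}) \<and> (i \<notin> {..<n} \<longrightarrow> l i = 0)}"
      using ptns_le_ptn_size[of l] ptns_zero_beyond[of l] by simp
  qed
qed (rule finite_set_of_finite_funs; simp)

lemma hstrips_below_self: "l \<in> ptns \<Longrightarrow> l \<in> hstrips_below l"
  using ptns_mono by (auto simp: hstrips_below_def)

lemma hstrips_below_ptns:
  assumes "k \<in> hstrips_below l" "l \<in> ptns"
  shows "k \<in> ptns"
proof -
  have "antimono k"
    using assms(1) by (intro decseq_SucI) (auto simp: hstrips_below_def intro: order_trans)
  moreover have "{i. k i \<noteq> 0} \<subseteq> {i. l i \<noteq> 0}"
  proof
    fix i assume "i \<in> {i. k i \<noteq> 0}"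
    moreover have "k i \<le> l i" using assms(1) by (simp add: hstrips_below_def)
    ultimately show "i \<in> {i. l i \<noteq> 0}" by simp
  qed
  ultimately show ?thesis
    using assms(2) by (auto simp: ptns_def intro: finite_subset)
qed

lemma hstrips_below_ptns_above:
  assumes "k \<in> hstrips_below l" "k \<in> ptns"
  shows "l \<in> ptns"
proof -
  have "antimono l"
    using assms(1) by (intro decseq_SucI) (auto simp: hstrips_below_def intro: order_trans)
  moreover have "{i. l i \<noteq> 0} \<subseteq> insert 0 (Suc ` {i. k i \<noteq> 0})"
  proof
    fix i assume "i \<in> {i. l i \<noteq> 0}"
    then show "i \<in> insert 0 (Suc ` {i. k i \<noteq> 0})"
    proof (cases i)
      case (Suc j)
      have "l (Suc j) \<le> k j" using assms(1) by (simp add: hstrips_below_def)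
      with Suc \<open>i \<in> _\<close> show ?thesis by auto
    qed simp
  qed
  ultimately show ?thesis
    using assms(2) by (auto simp: ptns_def intro: finite_subset)
qed

lemma hstrips_above_ptns: "l \<in> hstrips_above r k \<Longrightarrow> k \<in> ptns \<Longrightarrow> l \<in> ptns"
  using hstrips_below_ptns_above by (auto simp: hstrips_above_def)

lemma ptn_size_below_le:
  assumes "k \<in> hstrips_below l" "l \<in> ptns"
  shows "ptn_size k \<le> ptn_size l"
proof -
  have le: "k i \<le> l i" for i using assms(1) by (simp add: hstrips_below_def)
  have "ptn_size k = (\<Sum>i<ptn_size l. k i)"
    using le ptns_zero_beyond[OF assms(2)] by (intro ptn_size_eq_sum) (metis le_zero_eq)
  also have "\<dots> \<le> (\<Sum>i<ptn_size l. l i)" by (rule sum_mono) (rule le)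
  also have "\<dots> = ptn_size l"
    using ptns_zero_beyond[OF assms(2)] by (intro ptn_size_eq_sum[symmetric])
  finally show ?thesis .
qed

lemma ptn_size_below_less:
  assumes "k \<in> hstrips_below l" "l \<in> ptns" "k \<noteq> l"
  shows "ptn_size k < ptn_size l"
proof -
  have le: "k i \<le> l i" for i using assms(1) by (simp add: hstrips_below_def)
  obtain i where i: "k i \<noteq> l i" using assms(3) by auto
  with le[of i] have "k i < l i" by simp
  then have i': "i < ptn_size l"
    using ptns_zero_beyond[OF assms(2), of i] by (cases "i < ptn_size l") auto
  have "ptn_size k = (\<Sum>i<ptn_size l. k i)"
    using le ptns_zero_beyond[OF assms(2)] by (intro ptn_size_eq_sum) (metis le_zero_eq)
  also have "\<dots> < (\<Sum>i<ptn_size l. l i)"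
    by (rule sum_strict_mono_ex1) (use le i' \<open>k i < l i\<close> in auto)
  also have "\<dots> = ptn_size l"
    using ptns_zero_beyond[OF assms(2)] by (intro ptn_size_eq_sum[symmetric])
  finally show ?thesis .
qed

lemma finite_hstrips_below:
  assumes "l \<in> ptns"
  shows "finite (hstrips_below l)"
proof (rule finite_subset)
  show "hstrips_below l \<subseteq> (\<Union>n\<le>ptn_size l. ptns_of n)"
    using ptn_size_below_le hstrips_below_ptns assms by (auto simp: ptns_of_def)
qed (auto simp: finite_ptns_of)

lemma finite_hstrips_above:
  assumes "k \<in> ptns"
  shows "finite (hstrips_above r k)"
proof (rule finite_subset)
  show "hstrips_above r k \<subseteq> ptns_of (ptn_size k + r)"
    using hstrips_above_ptns assms by (auto simp: ptns_of_def hstrips_above_def)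
qed (rule finite_ptns_of)

lemma hstrips_above_0:
  assumes "k \<in> ptns"
  shows "hstrips_above 0 k = {k}"
  using ptn_size_below_less hstrips_above_ptns[OF _ assms] hstrips_below_self[OF assms]
  by (fastforce simp: hstrips_above_def)

text \<open>Summed over all rows, maxima and minima add up to \<open>\<mu>\<close> and
  \<open>\<nu>\<close>. As \<open>\<theta>\<close> and the maxima enter shifted by one row, their
  values in row \<open>0\<close> remain as corrections.\<close>

lemma ptn_size_reflect:
  assumes "\<theta> \<in> ptns" "\<kappa> \<in> ptns" "\<mu> \<in> ptns" "\<nu> \<in> ptns"
    and refl: "\<And>i. \<theta> (Suc i) + \<kappa> i = max (\<mu> (Suc i)) (\<nu> (Suc i)) + min (\<mu> i) (\<nu> i)"
  shows "ptn_size \<theta> + ptn_size \<kappa> + max (\<mu> 0) (\<nu> 0) = ptn_size \<mu> + ptn_size \<nu> + \<theta> 0"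
proof -
  define N where "N = ptn_size \<theta> + ptn_size \<kappa> + ptn_size \<mu> + ptn_size \<nu>"
  have 0: "\<theta> i = 0" "\<kappa> i = 0" "\<mu> i = 0" "\<nu> i = 0" if "N \<le> i" for i
    by (rule ptns_zero_beyond; use that assms(1-4) in \<open>simp add: N_def\<close>)+
  have sz: "ptn_size \<kappa> = (\<Sum>i<N. \<kappa> i)" "ptn_size \<mu> = (\<Sum>i<N. \<mu> i)" "ptn_size \<nu> = (\<Sum>i<N. \<nu> i)"
    "ptn_size \<theta> = (\<Sum>i<Suc N. \<theta> i)"
    by (rule ptn_size_eq_sum; use 0 in auto)+
  have "(\<Sum>i<N. \<theta> (Suc i)) + (\<Sum>i<N. \<kappa> i)
      = (\<Sum>i<N. max (\<mu> (Suc i)) (\<nu> (Suc i))) + (\<Sum>i<N. min (\<mu> i) (\<nu> i))"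
    by (simp add: refl flip: sum.distrib)
  moreover have "(\<Sum>i<N. max (\<mu> (Suc i)) (\<nu> (Suc i))) + max (\<mu> 0) (\<nu> 0) = (\<Sum>i<Suc N. max (\<mu> i) (\<nu> i))"
    by (subst sum.lessThan_Suc_shift) simp
  moreover have "(\<Sum>i<Suc N. max (\<mu> i) (\<nu> i)) = (\<Sum>i<N. max (\<mu> i) (\<nu> i))"
    using 0 by simp
  moreover have "(\<Sum>i<N. max (\<mu> i) (\<nu> i)) + (\<Sum>i<N. min (\<mu> i) (\<nu> i)) = ptn_size \<mu> + ptn_size \<nu>"
    unfolding sz sum.distrib[symmetric] by (rule sum.cong) auto
  moreover have "ptn_size \<theta> = \<theta> 0 + (\<Sum>i<N. \<theta> (Suc i))"
    unfolding sz by (rule sum.lessThan_Suc_shift)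
  ultimately show ?thesis
    unfolding sz by linarith
qed

text \<open>
  Given \<open>\<mu>\<close> and \<open>\<nu>\<close>, the entry \<open>\<theta> (Suc i)\<close> of a common upper neighbour and the entry \<open>\<kappa> i\<close> of a
  common lower neighbour range over the same interval, and the bijection reflects this interval; the
  first row of \<open>\<theta>\<close> is unbounded, which accounts for the parameter \<open>t\<close>.
\<close>

lemma sum_above_below_commute:
  fixes f :: "(nat \<Rightarrow> nat) \<Rightarrow> 'a::comm_monoid_add"
  assumes \<mu>: "\<mu> \<in> ptns"
  shows "(\<Sum>\<theta>\<in>hstrips_above r \<mu>. \<Sum>\<nu>\<in>hstrips_below \<theta>. f \<nu>)
    = (\<Sum>t\<le>r. \<Sum>\<kappa>\<in>hstrips_below \<mu>. \<Sum>\<nu>\<in>hstrips_above t \<kappa>. f \<nu>)"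
proof -
  \<comment> \<open>\<open>R\<close> reflects the interval from
    \<open>max (\<mu> (Suc i)) (\<nu> (Suc i))\<close> to
    \<open>min (\<mu> i) (\<nu> i)\<close>.\<close>
  define R where "R = (\<lambda>\<nu> (\<alpha>::nat \<Rightarrow> nat) i. max (\<mu> (Suc i)) (\<nu> (Suc i)) + min (\<mu> i) (\<nu> i) - \<alpha> i)"
  define A where "A = (SIGMA \<theta>:hstrips_above r \<mu>. hstrips_below \<theta>)"
  define B where "B = (SIGMA t:{..r}. SIGMA \<kappa>:hstrips_below \<mu>. hstrips_above t \<kappa>)"
  \<comment> \<open>The cells by which \<open>\<theta> 0\<close> exceeds both first rows are lost in
    the reflection; \<open>t\<close> is \<open>r\<close> minus their number, and it turns out to be
    the number of cells of \<open>\<nu>/\<kappa>\<close>.\<close>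
  define F where "F = (\<lambda>(\<theta>::nat\<Rightarrow>nat, \<nu>). (r - (\<theta> 0 - max (\<mu> 0) (\<nu> 0)), R \<nu> (\<lambda>i. \<theta> (Suc i)), \<nu>))"
  define G where "G = (\<lambda>(t, \<kappa>, \<nu>::nat\<Rightarrow>nat). (case_nat (max (\<mu> 0) (\<nu> 0) + (r - t)) (R \<nu> \<kappa>), \<nu>))"
  have F: "F z \<in> B \<and> G (F z) = z" if z: "z \<in> A" for z
  proof -
    obtain \<theta> \<nu> where z': "z = (\<theta>, \<nu>)" "\<mu> \<in> hstrips_below \<theta>" "ptn_size \<theta> = ptn_size \<mu> + r" "\<nu> \<in> hstrips_below \<theta>"
      using z by (auto simp: A_def hstrips_above_def)
    have b: "\<theta> (Suc i) \<le> \<mu> i" "\<mu> i \<le> \<theta> i" "\<theta> (Suc i) \<le> \<nu> i" "\<nu> i \<le> \<theta> i" for i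
      using z' by (auto simp: hstrips_below_def)
    define \<kappa> where "\<kappa> = R \<nu> (\<lambda>i. \<theta> (Suc i))"
    have refl: "\<theta> (Suc i) + \<kappa> i = max (\<mu> (Suc i)) (\<nu> (Suc i)) + min (\<mu> i) (\<nu> i)" for i
      using b[of i] by (simp add: \<kappa>_def R_def)
    have \<kappa>: "max (\<mu> (Suc i)) (\<nu> (Suc i)) \<le> \<kappa> i" "\<kappa> i \<le> min (\<mu> i) (\<nu> i)" for i
      using refl[of i] b[of i] b[of "Suc i"] by auto
    then have \<kappa>': "\<kappa> \<in> hstrips_below \<mu>" "\<kappa> \<in> hstrips_below \<nu>"
      by (auto simp: hstrips_below_def)
    have p: "\<theta> \<in> ptns" "\<nu> \<in> ptns" "\<kappa> \<in> ptns"
      using \<mu> z' \<kappa>' hstrips_below_ptns_above hstrips_below_ptns by blast+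
    have sz: "ptn_size \<theta> + ptn_size \<kappa> + max (\<mu> 0) (\<nu> 0) = ptn_size \<mu> + ptn_size \<nu> + \<theta> 0"
      by (rule ptn_size_reflect) (use p \<mu> refl in auto)
    \<comment> \<open>Together with \<open>sz\<close> this bounds the excess of
      \<open>\<theta> 0\<close> by \<open>r\<close>, so that the truncated subtraction from
      \<open>r\<close> is exact.\<close>
    have "ptn_size \<kappa> \<le> ptn_size \<nu>" by (rule ptn_size_below_le) (use \<kappa>' p in auto)
    moreover have "max (\<mu> 0) (\<nu> 0) \<le> \<theta> 0" using b[of 0] by simp
    ultimately have s: "\<theta> 0 - max (\<mu> 0) (\<nu> 0) \<le> r" "ptn_size \<nu> = ptn_size \<kappa> + (r - (\<theta> 0 - max (\<mu> 0) (\<nu> 0)))"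
      "max (\<mu> 0) (\<nu> 0) + (\<theta> 0 - max (\<mu> 0) (\<nu> 0)) = \<theta> 0"
      using sz z'(3) by linarith+
    have "R \<nu> \<kappa> i = \<theta> (Suc i)" for i
      using refl[of i] by (simp add: R_def)
    then have "case_nat (\<theta> 0) (R \<nu> \<kappa>) = \<theta>"
      by (auto simp: fun_eq_iff split: nat.split)
    then show ?thesis
      using s \<kappa>' unfolding z' F_def G_def B_def \<kappa>_def[symmetric]
      by (auto simp: hstrips_above_def \<kappa>_def[symmetric])
  qed
  have G: "G z \<in> A \<and> F (G z) = z" if z: "z \<in> B" for z
  proof -
    obtain t \<kappa> \<nu> where z': "z = (t, \<kappa>, \<nu>)" "t \<le> r" "\<kappa> \<in> hstrips_below \<mu>" "\<kappa> \<in> hstrips_below \<nu>"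
      "ptn_size \<nu> = ptn_size \<kappa> + t"
      using z by (auto simp: B_def hstrips_above_def)
    have b: "\<mu> (Suc i) \<le> \<kappa> i" "\<kappa> i \<le> \<mu> i" "\<nu> (Suc i) \<le> \<kappa> i" "\<kappa> i \<le> \<nu> i" for i
      using z' by (auto simp: hstrips_below_def)
    define \<theta> where "\<theta> = case_nat (max (\<mu> 0) (\<nu> 0) + (r - t)) (R \<nu> \<kappa>)"
    have \<theta>0: "\<theta> 0 = max (\<mu> 0) (\<nu> 0) + (r - t)" by (simp add: \<theta>_def)
    have refl: "\<theta> (Suc i) + \<kappa> i = max (\<mu> (Suc i)) (\<nu> (Suc i)) + min (\<mu> i) (\<nu> i)" for i
      using b[of i] by (simp add: \<theta>_def R_def)
    have \<theta>S: "max (\<mu> (Suc i)) (\<nu> (Suc i)) \<le> \<theta> (Suc i)" "\<theta> (Suc i) \<le> min (\<mu> i) (\<nu> i)" for i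
      using refl[of i] b[of i] by auto
    have "max (\<mu> i) (\<nu> i) \<le> \<theta> i" for i
      using \<theta>0 \<theta>S by (cases i) auto
    then have \<theta>': "\<mu> \<in> hstrips_below \<theta>" "\<nu> \<in> hstrips_below \<theta>"
      using \<theta>S(2) by (auto simp: hstrips_below_def)
    have p: "\<theta> \<in> ptns" "\<nu> \<in> ptns" "\<kappa> \<in> ptns"
      using \<mu> z' \<theta>' hstrips_below_ptns_above hstrips_below_ptns by blast+
    have "ptn_size \<theta> + ptn_size \<kappa> + max (\<mu> 0) (\<nu> 0) = ptn_size \<mu> + ptn_size \<nu> + \<theta> 0"
      by (rule ptn_size_reflect) (use p \<mu> refl in auto)
    then have s: "ptn_size \<theta> = ptn_size \<mu> + r"
      using z' \<theta>0 by linarith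
    have "R \<nu> (\<lambda>i. \<theta> (Suc i)) = \<kappa>"
      using refl by (auto simp: R_def fun_eq_iff simp flip: refl)
    moreover have "r - (\<theta> 0 - max (\<mu> 0) (\<nu> 0)) = t"
      using \<theta>0 z'(2) by simp
    ultimately have "F (\<theta>, \<nu>) = z"
      by (simp add: F_def z')
    moreover have "G z = (\<theta>, \<nu>)"
      by (simp add: G_def z' \<theta>_def)
    ultimately show ?thesis
      using s \<theta>' by (simp add: A_def hstrips_above_def)
  qed
  have "(\<Sum>\<theta>\<in>hstrips_above r \<mu>. \<Sum>\<nu>\<in>hstrips_below \<theta>. f \<nu>) = (\<Sum>(\<theta>, \<nu>)\<in>A. f \<nu>)"
    unfolding A_def using \<mu> hstrips_above_ptns finite_hstrips_below finite_hstrips_above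
    by (subst sum.Sigma) auto
  also have "\<dots> = (\<Sum>(t, \<kappa>, \<nu>)\<in>B. f \<nu>)"
    by (rule sum.reindex_bij_witness[of _ G F]) (use F G in \<open>auto simp: F_def split: prod.splits\<close>)
  also have "\<dots> = (\<Sum>t\<le>r. \<Sum>\<kappa>\<in>hstrips_below \<mu>. \<Sum>\<nu>\<in>hstrips_above t \<kappa>. f \<nu>)"
    unfolding B_def using \<mu> hstrips_below_ptns finite_hstrips_below finite_hstrips_above
    by (subst sum.Sigma[symmetric], simp, blast)+ simp
  finally show ?thesis .
qed

subsection \<open>Hook lengths and principal specializations\<close>

text \<open>Columns count from \<open>0\<close>, so \<open>l i - j\<close> is the arm together with
  the cell itself.\<close>

definition hook :: "(nat \<Rightarrow> nat) \<Rightarrow> nat \<Rightarrow> nat \<Rightarrow> nat" where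
  "hook l i j = l i - j + card {k. i < k \<and> j < l k}"

text \<open>Stanley's hook formula for the Schur function at \<open>1, x, x^2, ...\<close>, taken as
  the definition so that \<open>f_poly\<close> differs from it only by a factor
  \<open>qpoch\<close>.\<close>

definition principal_schur :: "'a::field \<Rightarrow> (nat \<Rightarrow> nat) \<Rightarrow> 'a" where
  "principal_schur x l =
     x ^ (\<Sum>i | l i \<noteq> 0. i * l i) / (\<Prod>(i, j) | j < l i. 1 - x ^ hook l i j)"

text \<open>
  The hook lengths in row \<open>i\<close> and the differences \<open>b i - b k\<close> for \<open>i < k < N\<close>, where
  \<open>b i = l i + (N - 1 - i)\<close>, together are the numbers from \<open>1\<close> to \<open>b i\<close>.
\<close>

lemma prod_hooks_row:
  assumes l: "l \<in> ptns" and N: "\<And>i. N \<le> i \<Longrightarrow> l i = 0" and i: "i < N"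
  shows "(\<Prod>j<l i. 1 - x ^ hook l i j) * (\<Prod>k\<in>{i<..<N}. 1 - x ^ (l i - l k + (k - i)))
    = qpoch x (l i + (N - 1 - i))"
proof -
  define leg where "leg = (\<lambda>j. card {k. i < k \<and> j < l k})"
  define A where "A = hook l i ` {..<l i}"
  define B where "B = (\<lambda>k. l i - l k + (k - i)) ` {i<..<N}"
  have fin: "finite {k. i < k \<and> j < l k}" for j
    by (rule finite_subset[of _ "{..<N}"]) (use N in \<open>auto simp: not_le[symmetric]\<close>)
  have leg_mono: "leg j' \<le> leg j" if "j \<le> j'" for j j'
    unfolding leg_def by (rule card_mono[OF fin]) (use that in auto)
  have leg_ge: "k - i \<le> leg j" if "j < l k" for j k
  proof -
    have "{i<..k} \<subseteq> {k. i < k \<and> j < l k}"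
      using ptns_mono[OF l] that by (auto intro: less_le_trans)
    from card_mono[OF fin this] show ?thesis by (simp add: leg_def)
  qed
  have leg_le: "leg j \<le> k - i - 1" if "l k \<le> j" for j k
  proof -
    have "{k. i < k \<and> j < l k} \<subseteq> {i<..<k}"
    proof
      fix m assume m: "m \<in> {k. i < k \<and> j < l k}"
      then show "m \<in> {i<..<k}"
        using ptns_mono[OF l, of k m] that by (cases "k \<le> m") auto
    qed
    from card_mono[OF _ this] show ?thesis by (simp add: leg_def)
  qed
  have hook: "hook l i j = l i - j + leg j" for j
    by (simp add: hook_def leg_def)
  have injA: "inj_on (hook l i) {..<l i}"
  proof (rule linorder_inj_onI')
    fix j j' assume "j \<in> {..<l i}" "j' \<in> {..<l i}" "j < j'"
    then show "hook l i j \<noteq> hook l i j'"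
      using leg_mono[of j j'] unfolding hook by simp
  qed
  have injB: "inj_on (\<lambda>k. l i - l k + (k - i)) {i<..<N}"
  proof (rule linorder_inj_onI')
    fix k k' assume "k \<in> {i<..<N}" "k' \<in> {i<..<N}" "k < k'"
    then show "l i - l k + (k - i) \<noteq> l i - l k' + (k' - i)"
      using ptns_mono[OF l, of k k'] ptns_mono[OF l, of i k] by simp
  qed
  have disj: "A \<inter> B = {}"
  proof -
    \<comment> \<open>The hook length is larger than the difference if \<open>j < l k\<close>, and
      smaller otherwise.\<close>
    have "hook l i j \<noteq> l i - l k + (k - i)" if "j < l i" "i < k" for j k
    proof (cases "j < l k")
      case True
      then show ?thesis
        using leg_ge[OF True] ptns_mono[OF l, of i k] that unfolding hook by simp
    next
      case False
      then show ?thesis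
        using leg_le[of k j] that unfolding hook by simp
    qed
    then show ?thesis by (force simp: A_def B_def)
  qed
  have cards: "card A = l i" "card B = N - 1 - i"
    using card_image[OF injA] card_image[OF injB] by (simp_all add: A_def B_def)
  \<comment> \<open>The disjoint sets \<open>A\<close> and \<open>B\<close> lie in this interval and
    their cardinalities add up to its length, so they fill it.\<close>
  have "A \<union> B \<subseteq> {1..l i + (N - 1 - i)}"
  proof -
    have "hook l i j \<in> {1..l i + (N - 1 - i)}" if "j < l i" for j
      using leg_le[of N j] N[of N] i that unfolding hook by auto
    moreover have "l i - l k + (k - i) \<in> {1..l i + (N - 1 - i)}" if "k \<in> {i<..<N}" for k
      using that by auto
    ultimately show ?thesis by (auto simp: A_def B_def)
  qed
  moreover have "card (A \<union> B) = l i + (N - 1 - i)"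
    using disj cards by (subst card_Un_disjoint) (auto simp: A_def B_def)
  ultimately have AB: "A \<union> B = {1..l i + (N - 1 - i)}"
    by (intro card_subset_eq) auto
  have "(\<Prod>j<l i. 1 - x ^ hook l i j) * (\<Prod>k\<in>{i<..<N}. 1 - x ^ (l i - l k + (k - i)))
    = (\<Prod>m\<in>A. 1 - x ^ m) * (\<Prod>m\<in>B. 1 - x ^ m)"
    unfolding A_def B_def by (simp only: prod.reindex[OF injA] prod.reindex[OF injB] o_def)
  also have "\<dots> = (\<Prod>m\<in>A \<union> B. 1 - x ^ m)"
    using disj by (subst prod.union_disjoint) (auto simp: A_def B_def)
  finally show ?thesis
    unfolding AB qpoch_def .
qed

lemma finite_diagram: "l \<in> ptns \<Longrightarrow> finite {(i, j). j < l i}"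
proof -
  assume l: "l \<in> ptns"
  have "{(i, j). j < l i} = Sigma {i. l i \<noteq> 0} (\<lambda>i. {..<l i})"
    by auto
  with l show ?thesis by (simp add: ptns_def)
qed

text \<open>The condition makes hook products and \<open>qpoch\<close> invertible. It will hold for
  the images of \<open>p\<close> and \<open>q\<close> in fields of fractions.\<close>

locale non_root_of_unity =
  fixes x :: "'a::field"
  assumes nonzero: "x \<noteq> 0" and power_neq_1: "0 < n \<Longrightarrow> x ^ n \<noteq> 1"
begin

lemma one_minus_power_nonzero: "0 < n \<Longrightarrow> 1 - x ^ n \<noteq> 0"
  using power_neq_1[of n] by (metis eq_iff_diff_eq_0)

lemma qpoch_neq_0: "qpoch x n \<noteq> 0"
  using qpoch_nonzero power_neq_1 by blast

lemma hook_product_nonzero: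
  assumes "l \<in> ptns"
  shows "(\<Prod>(i, j) | j < l i. 1 - x ^ hook l i j) \<noteq> 0"
  using finite_diagram[OF assms] one_minus_power_nonzero by (auto simp: hook_def)

text \<open>Multiplying \<open>prod_hooks_row\<close> over all rows gives the hook product times all
  \<open>1 - x ^ (b i - b k)\<close> with \<open>i < k\<close>. The power of \<open>x\<close>
  supplies a factor \<open>x ^ b k\<close> for each such pair and turns these into
  differences.\<close>

lemma principal_schur_vandermonde:
  assumes l: "l \<in> ptns" and N: "\<And>i. N \<le> i \<Longrightarrow> l i = 0"
  defines "b \<equiv> (\<lambda>i. l i + (N - 1 - i))"
  shows "x ^ (\<Sum>k<N. k * (N - 1 - k)) * principal_schur x l * (\<Prod>i<N. qpoch x (b i))
    = (\<Prod>k<N. \<Prod>i<k. x ^ b k - x ^ b i)"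
proof -
  define H where "H = (\<Prod>(i, j) | j < l i. 1 - x ^ hook l i j)"
  define E where "E = (\<Prod>i<N. \<Prod>k\<in>{i<..<N}. 1 - x ^ (l i - l k + (k - i)))"
  have cells: "{(i, j). j < l i} = Sigma {..<N} (\<lambda>i. {..<l i})"
    using N by (auto simp: not_le[symmetric])
  have "(\<Prod>i<N. qpoch x (b i)) = H * E"
  proof -
    have "(\<Prod>i<N. qpoch x (b i)) = (\<Prod>i<N. (\<Prod>j<l i. 1 - x ^ hook l i j) *
        (\<Prod>k\<in>{i<..<N}. 1 - x ^ (l i - l k + (k - i))))"
      unfolding b_def by (intro prod.cong refl prod_hooks_row[symmetric, OF l N]) auto
    then show ?thesis
      unfolding H_def E_def cells by (subst prod.Sigma[symmetric]) (auto simp: prod.distrib)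
  qed
  moreover have "H \<noteq> 0"
    using hook_product_nonzero[OF l] by (simp add: H_def)
  moreover have "(\<Sum>i | l i \<noteq> 0. i * l i) = (\<Sum>i<N. i * l i)"
    by (rule sum.mono_neutral_left) (use N in \<open>auto, metis leI less_irrefl\<close>)
  ultimately have "x ^ (\<Sum>k<N. k * (N - 1 - k)) * principal_schur x l * (\<Prod>i<N. qpoch x (b i))
    = x ^ (\<Sum>k<N. k * (N - 1 - k)) * x ^ (\<Sum>i<N. i * l i) * E"
    by (simp add: principal_schur_def flip: H_def)
  also have "\<dots> = x ^ (\<Sum>k<N. k * b k) * E"
    unfolding power_add[symmetric] sum.distrib[symmetric] b_def
    by (simp only: add_mult_distrib2 add.commute)
  also have "x ^ (\<Sum>k<N. k * b k) = (\<Prod>k<N. \<Prod>i<k. x ^ b k)"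
    by (simp add: power_sum power_mult mult.commute flip: power_mult)
  also have "E = (\<Prod>k<N. \<Prod>i<k. 1 - x ^ (l i - l k + (k - i)))"
    unfolding E_def
    by (subst (1 2) prod.Sigma, simp, simp, simp, simp,
        rule prod.reindex_bij_witness[of _ "\<lambda>(k, i). (i, k)" "\<lambda>(i, k). (k, i)"]) auto
  also have "(\<Prod>k<N. \<Prod>i<k. x ^ b k) * \<dots> = (\<Prod>k<N. \<Prod>i<k. x ^ b k - x ^ b i)"
    unfolding prod.distrib[symmetric]
  proof (intro prod.cong refl)
    fix k i assume "k \<in> {..<N}" "i \<in> {..<k}"
    then have "b k + (l i - l k + (k - i)) = b i"
      using ptns_mono[OF l, of i k] by (simp add: b_def)
    then show "x ^ b k * (1 - x ^ (l i - l k + (k - i))) = x ^ b k - x ^ b i"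
      by (simp add: algebra_simps flip: power_add)
  qed
  finally show ?thesis .
qed

text \<open>This is the complete homogeneous symmetric function of degree \<open>m - c\<close> at
  \<open>1, x, x^2, ...\<close>, zero in negative degree. The determinants below are thus
  Jacobi-Trudi determinants with the columns reversed.\<close>

definition inv_qpoch :: "nat \<Rightarrow> nat \<Rightarrow> 'a" where
  "inv_qpoch m c = (if c \<le> m then 1 / qpoch x (m - c) else 0)"

text \<open>The quotient of \<open>qpoch x m\<close> by \<open>qpoch x (m - c)\<close> is the
  product of the \<open>1 - x ^ (m - t)\<close> for \<open>t < c\<close>, a polynomial in
  \<open>x ^ m\<close>. For \<open>m < c\<close> the factor \<open>t = m\<close> vanishes, in
  agreement with the default value \<open>0\<close>.\<close>

lemma inv_qpoch_eq_poly:
  "inv_qpoch m c = 1 / qpoch x m * poly (\<Prod>t<c. [:1, - inverse (x ^ t):]) (x ^ m)"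
proof (induction c)
  case (Suc c)
  have "inv_qpoch m (Suc c) = inv_qpoch m c * (1 - x ^ m * inverse (x ^ c))"
  proof (cases "c < m")
    case True
    define d where "d = m - Suc c"
    have m: "m = Suc d + c" using True by (simp add: d_def)
    have "x ^ m * inverse (x ^ c) = x ^ Suc d"
      unfolding m power_add using nonzero by simp
    moreover have "m - c = Suc d" "m - Suc c = d"
      by (simp_all add: m)
    ultimately show ?thesis
      using True one_minus_power_nonzero[of "Suc d"]
      by (simp add: inv_qpoch_def qpoch_Suc del: power_Suc)
  qed (use nonzero in \<open>auto simp: inv_qpoch_def not_less le_eq_less_or_eq\<close>)
  with Suc show ?case by (simp add: algebra_simps diff_divide_distrib)
qed (simp add: inv_qpoch_def)

text \<open>For \<open>d = Suc m - c > 0\<close> this is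
  \<open>1 / qpoch x d - 1 / qpoch x (d - 1) = x ^ d / qpoch x d\<close>, multiplied by
  \<open>x ^ c\<close>.\<close>

lemma inv_qpoch_diff:
  "x ^ Suc m * inv_qpoch (Suc m) c = (inv_qpoch (Suc m) c - inv_qpoch m c) * x ^ c"
proof -
  consider "c \<le> m" | "c = Suc m" | "Suc m < c" by linarith
  then show ?thesis
  proof cases
    case 1
    define d where "d = m - c"
    have m: "m = d + c" using 1 by (simp add: d_def)
    show ?thesis
      using qpoch_neq_0[of d] one_minus_power_nonzero[of "Suc d"]
      by (simp add: inv_qpoch_def m Suc_diff_le qpoch_Suc power_add divide_simps)
  qed (auto simp: inv_qpoch_def)
qed

text \<open>\<open>inv_qpoch_diff\<close> telescopes; for \<open>a + d = 0\<close> the term before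
  the first would have index \<open>-1\<close> and is read as \<open>0\<close>.\<close>

lemma inv_qpoch_telescope:
  assumes "a \<le> b"
  shows "(\<Sum>m = a..b. x ^ (m + d) * inv_qpoch (m + d) c)
    = (inv_qpoch (b + d) c - (if a + d = 0 then 0 else inv_qpoch (a + d - 1) c)) * x ^ c"
  using assms
proof (induction b rule: dec_induct)
  case base
  show ?case
  proof (cases "a + d")
    case 0
    then show ?thesis by (cases c) (auto simp: inv_qpoch_def)
  next
    case (Suc m)
    then show ?thesis using inv_qpoch_diff[of m c] by simp
  qed
next
  case (step b)
  then show ?case
    using inv_qpoch_diff[of "b + d" c] by (simp add: algebra_simps)
qed

text \<open>After the row factors \<open>1 / qpoch x (b i)\<close> are extracted, column
  \<open>c\<close> is a polynomial of degree \<open>c\<close> in \<open>x ^ b i\<close>, so that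
  \<open>fdet_poly\<close> yields the product in \<open>principal_schur_vandermonde\<close>. It
  matters that \<open>C\<close> is the same for all \<open>l\<close>.\<close>

lemma principal_schur_det:
  obtains C where "C \<noteq> 0"
    "\<And>l. l \<in> ptns \<Longrightarrow> (\<And>i. N \<le> i \<Longrightarrow> l i = 0) \<Longrightarrow>
      fdet N (\<lambda>i c. inv_qpoch (l i + (N - 1 - i)) c) = C * principal_schur x l"
proof
  define p where "p = (\<lambda>c. \<Prod>t<c. [:1, - inverse (x ^ t):])"
  have deg: "degree (p c) = c" for c
    unfolding p_def by (subst degree_prod_eq_sum_degree) (use nonzero in auto)
  define C where "C = (\<Prod>c<N. coeff (p c) c) * x ^ (\<Sum>k<N. k * (N - 1 - k))"
  have "p c \<noteq> 0" for c
    unfolding p_def by simp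
  then have "coeff (p c) c \<noteq> 0" for c
    using deg[of c] by (metis leading_coeff_0_iff)
  then show "C \<noteq> 0"
    using nonzero by (simp add: C_def)
  fix l assume l: "l \<in> ptns" and N: "\<And>i. N \<le> i \<Longrightarrow> l i = 0"
  define b where "b = (\<lambda>i. l i + (N - 1 - i))"
  have "fdet N (\<lambda>i c. inv_qpoch (b i) c) = (\<Prod>i<N. 1 / qpoch x (b i)) * fdet N (\<lambda>i c. poly (p c) (x ^ b i))"
    unfolding p_def inv_qpoch_eq_poly by (rule fdet_scale_rows)
  also have "fdet N (\<lambda>i c. poly (p c) (x ^ b i))
      = (\<Prod>c<N. coeff (p c) c) * (\<Prod>k<N. \<Prod>i<k. x ^ b k - x ^ b i)"
    by (rule fdet_poly) (simp add: deg)
  also have "(\<Prod>k<N. \<Prod>i<k. x ^ b k - x ^ b i)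
      = x ^ (\<Sum>k<N. k * (N - 1 - k)) * principal_schur x l * (\<Prod>i<N. qpoch x (b i))"
    unfolding b_def by (rule principal_schur_vandermonde[symmetric, OF l N])
  finally show "fdet N (\<lambda>i c. inv_qpoch (l i + (N - 1 - i)) c) = C * principal_schur x l"
    using qpoch_neq_0 by (simp add: b_def C_def prod_dividef)
qed

text \<open>Interlacing bounds each row independently, so the sum over \<open>k\<close> is one
  determinant of row sums. Each row sum telescopes to a difference of consecutive rows, which leaves
  the determinant unchanged, times the column factor \<open>x ^ c\<close>.\<close>

lemma principal_schur_branching:
  assumes l: "l \<in> ptns"
  shows "principal_schur x l = (\<Sum>k\<in>hstrips_below l. x ^ ptn_size k * principal_schur x k)"
proof -
  \<comment> \<open>\<open>N\<close> rows suffice for \<open>l\<close> and for all \<open>k\<close>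
    below it, so the constant \<open>C\<close> is common to all terms.\<close>
  define N where "N = ptn_size l"
  have N: "l i = 0" if "N \<le> i" for i
    using that l ptns_zero_beyond by (simp add: N_def)
  obtain C where C: "C \<noteq> 0" and
    det: "\<And>l. l \<in> ptns \<Longrightarrow> (\<And>i. N \<le> i \<Longrightarrow> l i = 0) \<Longrightarrow>
      fdet N (\<lambda>i c. inv_qpoch (l i + (N - 1 - i)) c) = C * principal_schur x l"
    using principal_schur_det[of N] by metis
  define P where "P = PiE {..<N} (\<lambda>i. {l (Suc i)..l i})"
  \<comment> \<open>\<open>x ^ T\<close> completes \<open>x ^ ptn_size k\<close> to the product of
    the row factors; it reappears as the product of the column factors \<open>x ^ c\<close>.\<close>
  define T where "T = (\<Sum>i<N. N - 1 - i)"
  have T: "T = (\<Sum>c<N. c)"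
    using sum.nat_diff_reindex[of "\<lambda>c. c" N] by (simp add: T_def)
  have k: "k \<in> ptns" "\<And>i. N \<le> i \<Longrightarrow> k i = 0" if "k \<in> hstrips_below l" for k
  proof -
    show "k \<in> ptns" using hstrips_below_ptns[OF that l] .
    fix i assume "N \<le> i"
    moreover have "k i \<le> l i" using that by (simp add: hstrips_below_def)
    ultimately show "k i = 0" using N by simp
  qed
  have "x ^ T * (\<Sum>k\<in>hstrips_below l. x ^ ptn_size k * (C * principal_schur x k))
    = (\<Sum>k\<in>hstrips_below l. fdet N (\<lambda>i c. x ^ (k i + (N - 1 - i)) * inv_qpoch (k i + (N - 1 - i)) c))"
    unfolding sum_distrib_left
  proof (rule sum.cong[OF refl])
    fix k assume k': "k \<in> hstrips_below l"
    have "ptn_size k = (\<Sum>i<N. k i)"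
      by (rule ptn_size_eq_sum) (rule k(2)[OF k'])
    then have "x ^ T * x ^ ptn_size k = (\<Prod>i<N. x ^ (k i + (N - 1 - i)))"
      by (simp only: T_def power_sum power_add prod.distrib mult.commute)
    then show "x ^ T * (x ^ ptn_size k * (C * principal_schur x k))
      = fdet N (\<lambda>i c. x ^ (k i + (N - 1 - i)) * inv_qpoch (k i + (N - 1 - i)) c)"
      by (simp only: fdet_scale_rows det[OF k(1)[OF k'] k(2)[OF k']] flip: mult.assoc)
  qed
  also have "\<dots> = (\<Sum>k\<in>P. fdet N (\<lambda>i c. x ^ (k i + (N - 1 - i)) * inv_qpoch (k i + (N - 1 - i)) c))"
  \<comment> \<open>Beyond \<open>N\<close>, partitions are \<open>0\<close> whereas the functions
    in \<open>P\<close> are \<open>undefined\<close>.\<close>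
  proof (rule sum.reindex_bij_witness[of _ "\<lambda>k i. if i < N then k i else 0" "\<lambda>k. restrict k {..<N}"])
    fix k assume k': "k \<in> hstrips_below l"
    show "(\<lambda>i. if i < N then restrict k {..<N} i else 0) = k"
      using k(2)[OF k'] by (auto simp: fun_eq_iff)
    show "restrict k {..<N} \<in> P"
      using k' by (auto simp: P_def hstrips_below_def)
    show "fdet N (\<lambda>i c. x ^ (restrict k {..<N} i + (N - 1 - i)) * inv_qpoch (restrict k {..<N} i + (N - 1 - i)) c)
      = fdet N (\<lambda>i c. x ^ (k i + (N - 1 - i)) * inv_qpoch (k i + (N - 1 - i)) c)"
      by (rule fdet_cong) simp
  next
    fix k assume k': "k \<in> P"
    show "restrict (\<lambda>i. if i < N then k i else 0) {..<N} = k"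
    proof
      fix i
      show "restrict (\<lambda>i. if i < N then k i else 0) {..<N} i = k i"
        using k' PiE_arb[of k "{..<N}" _ i] unfolding P_def by (cases "i < N") auto
    qed
    show "(\<lambda>i. if i < N then k i else 0) \<in> hstrips_below l"
      unfolding hstrips_below_def
    proof (intro CollectI allI conjI)
      fix i
      have "k i \<in> {l (Suc i)..l i}" if "i < N"
        using k' that PiE_mem[of k "{..<N}" _ i] unfolding P_def by blast
      then show "l (Suc i) \<le> (if i < N then k i else 0)" "(if i < N then k i else 0) \<le> l i"
        using N[of "Suc i"] by (cases "i < N"; simp)+
    qed
  qed
  also have "\<dots> = fdet N (\<lambda>i c. \<Sum>m = l (Suc i)..l i. x ^ (m + (N - 1 - i)) * inv_qpoch (m + (N - 1 - i)) c)"
    unfolding P_def by (rule fdet_sum_rows[symmetric]) simp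
  also have "\<dots> = fdet N (\<lambda>i c. (inv_qpoch (l i + (N - 1 - i)) c
      - (if Suc i < N then inv_qpoch (l (Suc i) + (N - 1 - Suc i)) c else 0)) * x ^ c)"
  proof (rule fdet_cong)
    fix i c assume i: "i < N"
    \<comment> \<open>The lower end of the telescoping sum in row \<open>i\<close> is the index of
      row \<open>Suc i\<close>; in the last row it is \<open>-1\<close>, since
      \<open>l N = 0\<close>.\<close>
    have eq: "(if l (Suc i) + (N - 1 - i) = 0 then 0 else inv_qpoch (l (Suc i) + (N - 1 - i) - 1) c)
      = (if Suc i < N then inv_qpoch (l (Suc i) + (N - 1 - Suc i)) c else 0)"
    proof (cases "Suc i < N")
      case True
      then have "l (Suc i) + (N - 1 - i) = Suc (l (Suc i) + (N - 1 - Suc i))" by simp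
      with True show ?thesis by simp
    next
      case False
      with i N[of "Suc i"] show ?thesis by simp
    qed
    show "(\<Sum>m = l (Suc i)..l i. x ^ (m + (N - 1 - i)) * inv_qpoch (m + (N - 1 - i)) c)
      = (inv_qpoch (l i + (N - 1 - i)) c
      - (if Suc i < N then inv_qpoch (l (Suc i) + (N - 1 - Suc i)) c else 0)) * x ^ c"
      using inv_qpoch_telescope[of "l (Suc i)" "l i" "N - 1 - i" c] ptns_mono[OF l, of i "Suc i"]
      unfolding eq by simp
  qed
  also have "\<dots> = C * principal_schur x l * x ^ T"
    unfolding fdet_scale_columns fdet_row_diff[of N "\<lambda>i c. inv_qpoch (l i + (N - 1 - i)) c"] T
    using det[OF l N] by (simp add: power_sum)
  finally have "C * x ^ T * (\<Sum>k\<in>hstrips_below l. x ^ ptn_size k * principal_schur x k)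
    = C * x ^ T * principal_schur x l"
    by (simp add: sum_distrib_left mult_ac)
  then show ?thesis
    using C nonzero by simp
qed

section \<open>The Pieri rule\<close>

lemma sum_power_div_qpoch: "(\<Sum>t\<le>r. x ^ t / qpoch x t) = 1 / qpoch x r"
proof (induction r)
  case (Suc r)
  then show ?case
    using qpoch_neq_0[of r] one_minus_power_nonzero[of "Suc r"]
    by (simp add: qpoch_Suc divide_simps) (simp add: algebra_simps)
qed simp

text \<open>Both sides satisfy one recursion: the value at \<open>(\<mu>, r)\<close> is the sum over
  \<open>t \<le> r\<close> and \<open>\<kappa>\<close> below \<open>\<mu>\<close> of
  \<open>x ^ (ptn_size \<kappa> + t)\<close> times the value at \<open>(\<kappa>, t)\<close>. For
  the left side this is branching followed by \<open>sum_above_below_commute\<close>. All terms but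
  \<open>(\<mu>, r)\<close> itself are smaller, so induction applies to them.\<close>

lemma principal_schur_pieri:
  assumes "\<mu> \<in> ptns"
  shows "(\<Sum>l\<in>hstrips_above r \<mu>. principal_schur x l) = principal_schur x \<mu> / qpoch x r"
  using assms
proof (induction "ptn_size \<mu> + r" arbitrary: \<mu> r rule: less_induct)
  case less
  define X where "X = (\<lambda>\<mu> r. \<Sum>l\<in>hstrips_above r \<mu>. principal_schur x l)"
  define Y where "Y = (\<lambda>\<mu> r. principal_schur x \<mu> / qpoch x r)"
  define n where "n = ptn_size \<mu> + r"
  define Z where "Z = {..r} \<times> hstrips_below \<mu>"
  have Z: "finite Z" "(r, \<mu>) \<in> Z"
    using finite_hstrips_below hstrips_below_self less.prems by (auto simp: Z_def)
  have "X \<mu> r = (\<Sum>l\<in>hstrips_above r \<mu>. \<Sum>\<nu>\<in>hstrips_below l. x ^ ptn_size \<nu> * principal_schur x \<nu>)"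
    unfolding X_def
    by (rule sum.cong[OF refl], rule principal_schur_branching, rule hstrips_above_ptns)
       (assumption, rule less.prems)
  also have "\<dots> = (\<Sum>t\<le>r. \<Sum>\<kappa>\<in>hstrips_below \<mu>. \<Sum>\<nu>\<in>hstrips_above t \<kappa>. x ^ ptn_size \<nu> * principal_schur x \<nu>)"
    by (rule sum_above_below_commute) (rule less.prems)
  also have "\<dots> = (\<Sum>t\<le>r. \<Sum>\<kappa>\<in>hstrips_below \<mu>. x ^ (ptn_size \<kappa> + t) * X \<kappa> t)"
    by (auto simp: X_def sum_distrib_left hstrips_above_def intro!: sum.cong)
  finally have "X \<mu> r = (\<Sum>(t, \<kappa>)\<in>Z. x ^ (ptn_size \<kappa> + t) * X \<kappa> t)"
    by (simp add: Z_def sum.cartesian_product)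
  then have X: "X \<mu> r = x ^ n * X \<mu> r + (\<Sum>(t, \<kappa>)\<in>Z - {(r, \<mu>)}. x ^ (ptn_size \<kappa> + t) * X \<kappa> t)"
    by (simp add: sum.remove[OF Z] n_def)
  \<comment> \<open>The sum over \<open>t\<close> is the branching rule for a single row of length
    \<open>r\<close>.\<close>
  have "Y \<mu> r = (\<Sum>t\<le>r. x ^ t / qpoch x t) * (\<Sum>\<kappa>\<in>hstrips_below \<mu>. x ^ ptn_size \<kappa> * principal_schur x \<kappa>)"
    using principal_schur_branching[OF less.prems] by (simp add: Y_def sum_power_div_qpoch)
  also have "\<dots> = (\<Sum>(t, \<kappa>)\<in>Z. x ^ (ptn_size \<kappa> + t) * Y \<kappa> t)"
    unfolding sum_product Z_def sum.cartesian_product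
    by (rule sum.cong) (auto simp: Y_def power_add)
  finally have Y: "Y \<mu> r = x ^ n * Y \<mu> r + (\<Sum>(t, \<kappa>)\<in>Z - {(r, \<mu>)}. x ^ (ptn_size \<kappa> + t) * Y \<kappa> t)"
    by (simp add: sum.remove[OF Z] n_def)
  have "X \<kappa> t = Y \<kappa> t" if "(t, \<kappa>) \<in> Z - {(r, \<mu>)}" for t \<kappa>
  proof -
    have \<kappa>: "\<kappa> \<in> hstrips_below \<mu>" "t \<le> r" using that by (auto simp: Z_def)
    have "ptn_size \<kappa> + t < ptn_size \<mu> + r"
    proof (cases "\<kappa> = \<mu>")
      case True
      with that \<kappa> show ?thesis by auto
    next
      case False
      with \<kappa> less.prems ptn_size_below_less show ?thesis by (simp add: add_less_le_mono)
    qed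
    then show ?thesis
      unfolding X_def Y_def using hstrips_below_ptns[OF \<kappa>(1) less.prems] by (rule less.hyps)
  qed
  then have "(\<Sum>(t, \<kappa>)\<in>Z - {(r, \<mu>)}. x ^ (ptn_size \<kappa> + t) * X \<kappa> t)
    = (\<Sum>(t, \<kappa>)\<in>Z - {(r, \<mu>)}. x ^ (ptn_size \<kappa> + t) * Y \<kappa> t)"
    by (intro sum.cong refl) (simp only: split_paired_all prod.case)
  moreover have "X \<mu> r - x ^ n * X \<mu> r = (\<Sum>(t, \<kappa>)\<in>Z - {(r, \<mu>)}. x ^ (ptn_size \<kappa> + t) * X \<kappa> t)"
    unfolding diff_eq_eq by (subst add.commute) (rule X)
  moreover have "Y \<mu> r - x ^ n * Y \<mu> r = (\<Sum>(t, \<kappa>)\<in>Z - {(r, \<mu>)}. x ^ (ptn_size \<kappa> + t) * Y \<kappa> t)"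
    unfolding diff_eq_eq by (subst add.commute) (rule Y)
  ultimately have "X \<mu> r - x ^ n * X \<mu> r = Y \<mu> r - x ^ n * Y \<mu> r"
    by (simp only:)
  then have "(1 - x ^ n) * X \<mu> r = (1 - x ^ n) * Y \<mu> r"
    by (simp add: algebra_simps)
  show ?case
  proof (cases "n = 0")
    \<comment> \<open>Here \<open>1 - x ^ n\<close> is zero and cannot be cancelled, but both sides
      reduce to \<open>principal_schur x \<mu>\<close>.\<close>
    case True
    then have "r = 0" by (simp add: n_def)
    then show ?thesis using hstrips_above_0[OF less.prems] by simp
  next
    case False
    then have "X \<mu> r = Y \<mu> r"
      using \<open>(1 - x ^ n) * X \<mu> r = _\<close> one_minus_power_nonzero[of n] by (metis mult_left_cancel neq0_conv)
    then show ?thesis by (simp only: X_def Y_def)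
  qed
qed

end

section \<open>The Cauchy sum over partitions of fixed size\<close>

definition cauchy_sum :: "'a::field \<Rightarrow> 'a \<Rightarrow> nat \<Rightarrow> 'a" where
  "cauchy_sum x y n = (\<Sum>l\<in>ptns_of n. principal_schur x l * principal_schur y l)"

text \<open>Branching in \<open>x\<close> introduces a smaller partition \<open>k\<close>, of size
  \<open>j\<close>; once \<open>k\<close> is summed last, the Pieri rule in \<open>y\<close>
  evaluates the sum over the strips \<open>l\<close> above it.\<close>

lemma cauchy_sum_recursion:
  assumes "non_root_of_unity x" "non_root_of_unity y"
  shows "cauchy_sum x y n = (\<Sum>j\<le>n. x ^ j * cauchy_sum x y j / qpoch y (n - j))"
proof -
  interpret x: non_root_of_unity x by fact
  interpret y: non_root_of_unity y by fact
  have ptns: "l \<in> ptns_of m \<Longrightarrow> l \<in> ptns" for l m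
    by (simp add: ptns_of_def)
  define A where "A = (SIGMA l:ptns_of n. hstrips_below l)"
  define B where "B = (SIGMA j:{..n}. SIGMA k:ptns_of j. hstrips_above (n - j) k)"
  have "cauchy_sum x y n = (\<Sum>l\<in>ptns_of n. \<Sum>k\<in>hstrips_below l.
      x ^ ptn_size k * principal_schur x k * principal_schur y l)"
    unfolding cauchy_sum_def
    by (rule sum.cong) (use x.principal_schur_branching in \<open>auto simp: ptns_of_def sum_distrib_right\<close>)
  also have "\<dots> = (\<Sum>(l, k)\<in>A. x ^ ptn_size k * principal_schur x k * principal_schur y l)"
    unfolding A_def by (subst sum.Sigma) (auto simp: finite_ptns_of dest: ptns intro!: finite_hstrips_below)
  also have "\<dots> = (\<Sum>(j, k, l)\<in>B. x ^ j * principal_schur x k * principal_schur y l)"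
  proof (rule sum.reindex_bij_witness[of _ "\<lambda>(j, k, l). (l, k)" "\<lambda>(l, k). (ptn_size k, k, l)"])
    fix z assume "z \<in> B"
    then obtain j k l where z: "z = (j, k, l)" "j \<le> n" "k \<in> ptns_of j" "l \<in> hstrips_above (n - j) k"
      by (auto simp: B_def)
    then show "(\<lambda>(l, k). (ptn_size k, k, l)) ((\<lambda>(j, k, l). (l, k)) z) = z"
      by (simp add: ptns_of_def)
    show "(\<lambda>(j, k, l). (l, k)) z \<in> A"
      using z hstrips_above_ptns[OF z(4)] by (auto simp: A_def ptns_of_def hstrips_above_def)
  next
    fix z assume "z \<in> A"
    then obtain l k where z: "z = (l, k)" "l \<in> ptns" "ptn_size l = n" "k \<in> hstrips_below l"
      by (auto simp: A_def ptns_of_def)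
    then show "(\<lambda>(l, k). (ptn_size k, k, l)) z \<in> B"
      using hstrips_below_ptns ptn_size_below_le[of k l]
      by (auto simp: B_def ptns_of_def hstrips_above_def)
  qed auto
  also have "\<dots> = (\<Sum>j\<le>n. \<Sum>k\<in>ptns_of j. \<Sum>l\<in>hstrips_above (n - j) k.
      x ^ j * principal_schur x k * principal_schur y l)"
    unfolding B_def using finite_hstrips_above
    by (subst sum.Sigma[symmetric], simp add: finite_ptns_of,
        blast intro: finite_SigmaI finite_ptns_of dest: ptns)+ simp
  also have "\<dots> = (\<Sum>j\<le>n. \<Sum>k\<in>ptns_of j. x ^ j * principal_schur x k * (principal_schur y k / qpoch y (n - j)))"
    by (intro sum.cong refl)
       (simp add: y.principal_schur_pieri[symmetric] ptns_of_def flip: sum_distrib_left)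
  also have "\<dots> = (\<Sum>j\<le>n. x ^ j * cauchy_sum x y j / qpoch y (n - j))"
    by (simp add: cauchy_sum_def sum_distrib_left sum_divide_distrib mult.assoc)
  finally show ?thesis .
qed

subsection \<open>Integrality\<close>

lemma qpoch_mult_tail:
  assumes "m \<le> n"
  shows "qpoch x n = qpoch x m * (\<Prod>i = m + 1..n. 1 - x ^ i)"
  using prod.ub_add_nat[of 1 m "\<lambda>i. 1 - x ^ i" "n - m"] assms by (simp add: qpoch_def)

lemma (in comm_ring_hom) hom_qpoch: "hom (qpoch x n) = qpoch (hom x) n"
  by (induction n) (simp_all add: qpoch_Suc hom_distribs)

interpretation to_fract_hom: comm_ring_hom to_fract
  by unfold_locales auto

lemma non_root_of_unity_to_fract:
  assumes "x \<noteq> 0" "\<And>n. 0 < n \<Longrightarrow> x ^ n \<noteq> 1"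
  shows "non_root_of_unity (to_fract x)"
proof
  show "to_fract x \<noteq> 0" using assms by simp
  fix n :: nat assume "0 < n"
  then show "to_fract x ^ n \<noteq> 1"
    using assms(2)[of n] by (metis to_fract_1 to_fract_eq_iff to_fract_hom.hom_power)
qed

lemma non_root_of_unity_qvar: "non_root_of_unity (to_fract qvar)"
  by (rule non_root_of_unity_to_fract) (use qvar_power_neq_1 in auto)

lemma non_root_of_unity_fps_const_qvar: "non_root_of_unity (to_fract (fps_const qvar))"
proof (rule non_root_of_unity_to_fract)
  fix n :: nat assume "0 < n"
  then have "fps_nth (fps_const (qvar ^ n)) 0 \<noteq> fps_nth 1 0"
    using qvar_power_neq_1[of n] by simp
  then show "fps_const qvar ^ n \<noteq> 1"
    by (metis fps_const_power)
qed simp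

lemma non_root_of_unity_fps_X: "non_root_of_unity (to_fract (fps_X :: int poly fps))"
proof (rule non_root_of_unity_to_fract)
  fix n :: nat assume "0 < n"
  then have "fps_nth (fps_X ^ n :: int poly fps) 0 \<noteq> fps_nth 1 0"
    by (simp add: fps_X_power_nth)
  then show "fps_X ^ n \<noteq> (1 :: int poly fps)" by metis
qed simp

lemma principal_schur_size_0:
  assumes "l \<in> ptns" "ptn_size l = 0"
  shows "principal_schur x l = 1"
  using ptns_zero_beyond[OF assms(1)] assms(2) by (simp add: principal_schur_def)

text \<open>Moving the term \<open>k = l\<close> of the branching rule to the left gives
  \<open>1 - x ^ m\<close> times the function of \<open>l\<close> as a sum over smaller
  \<open>k\<close>. The bound \<open>ptn_size l \<le> n\<close> lets one factor
  \<open>qpoch x m'\<close> clear the denominators of all these \<open>k\<close>, whatever their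
  sizes.\<close>

lemma principal_schur_in_range:
  assumes "l \<in> ptns" "ptn_size l \<le> n"
  shows "principal_schur (to_fract qvar) l * qpoch (to_fract qvar) n \<in> range to_fract"
  using assms
proof (induction "ptn_size l" arbitrary: l n rule: less_induct)
  case less
  define x where "x = to_fract qvar"
  interpret non_root_of_unity x
    unfolding x_def by (rule non_root_of_unity_qvar)
  have mult: "a * b \<in> range to_fract" if "a \<in> range to_fract" "b \<in> range to_fract" for a b :: "int poly fract"
    using that by (metis (no_types, opaque_lifting) image_iff rangeI to_fract_mult)
  have sum: "sum f A \<in> range to_fract" if "\<And>a. a \<in> A \<Longrightarrow> f a \<in> range to_fract"
    for f :: "(nat \<Rightarrow> nat) \<Rightarrow> int poly fract" and A
  proof -
    have "\<forall>a\<in>A. \<exists>P. f a = to_fract P" using that by auto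
    then obtain g where "\<And>a. a \<in> A \<Longrightarrow> f a = to_fract (g a)" by metis
    then have "sum f A = to_fract (sum g A)"
      by (simp add: to_fract_hom.hom_sum)
    then show ?thesis by (simp only: rangeI)
  qed
  have qp: "x ^ m \<in> range to_fract" "(\<Prod>i = k..m. 1 - x ^ i) \<in> range to_fract" for k m
    by (auto simp: x_def simp flip: to_fract_hom.hom_power to_fract_1 to_fract_diff to_fract_hom.hom_prod)
  define m where "m = ptn_size l"
  have "principal_schur x l * qpoch x m \<in> range to_fract"
  proof (cases m)
    case 0
    then have "principal_schur x l * qpoch x m = to_fract 1"
      using principal_schur_size_0[of l x] less.prems(1) by (simp add: m_def)
    then show ?thesis by (simp only: rangeI)
  next
    case (Suc m')
    have "principal_schur x l = x ^ m * principal_schur x l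
        + (\<Sum>k\<in>hstrips_below l - {l}. x ^ ptn_size k * principal_schur x k)"
      unfolding m_def
      by (rule trans[OF principal_schur_branching sum.remove])
         (rule less.prems(1) finite_hstrips_below hstrips_below_self)+
    then have S: "principal_schur x l * (1 - x ^ m) = (\<Sum>k\<in>hstrips_below l - {l}. x ^ ptn_size k * principal_schur x k)"
      unfolding right_diff_distrib mult_1_right diff_eq_eq
      by (simp only: add.commute mult.commute)
    have "principal_schur x l * qpoch x m = principal_schur x l * (1 - x ^ m) * qpoch x m'"
      by (simp only: Suc qpoch_Suc mult_ac)
    also have "\<dots> = (\<Sum>k\<in>hstrips_below l - {l}. x ^ ptn_size k * (principal_schur x k * qpoch x m'))"
      by (simp only: S sum_distrib_right mult.assoc)
    also have "\<dots> \<in> range to_fract"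
    proof (rule sum, rule mult[OF qp(1)])
      fix k assume k: "k \<in> hstrips_below l - {l}"
      then have "ptn_size k < ptn_size l"
        using less.prems by (intro ptn_size_below_less) auto
      moreover have "k \<in> ptns"
        using k hstrips_below_ptns less.prems by blast
      ultimately show "principal_schur x k * qpoch x m' \<in> range to_fract"
        using less.hyps[of k m'] Suc by (simp add: x_def m_def)
    qed
    finally show ?thesis .
  qed
  then have "principal_schur x l * qpoch x m * (\<Prod>i = m + 1..n. 1 - x ^ i) \<in> range to_fract"
    by (rule mult[OF _ qp(2)])
  then show ?case
    using less.prems qpoch_mult_tail[of m n x] by (simp add: m_def mult.assoc flip: x_def)
qed

subsection \<open>The sum over partitions\<close>

definition row_fun :: "nat list \<Rightarrow> nat \<Rightarrow> nat" where
  "row_fun \<mu> i = (if i < length \<mu> then \<mu> ! i else 0)"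

lemma row_fun_nonzero: "is_partition \<mu> \<Longrightarrow> {i. row_fun \<mu> i \<noteq> 0} = {..<length \<mu>}"
  by (auto simp: row_fun_def is_partition_def)

lemma row_fun_ptns:
  assumes "is_partition \<mu>"
  shows "row_fun \<mu> \<in> ptns_of (sum_list \<mu>)"
proof -
  have "antimono (row_fun \<mu>)"
    using assms unfolding antimono_def row_fun_def is_partition_def sorted_wrt_iff_nth_less
    by (auto simp: le_less)
  moreover have "ptn_size (row_fun \<mu>) = sum_list \<mu>"
    unfolding ptn_size_def row_fun_nonzero[OF assms] sum_list_sum_nth
    by (rule sum.cong) (auto simp: row_fun_def)
  ultimately show ?thesis
    using row_fun_nonzero[OF assms] by (simp add: ptns_of_def ptns_def)
qed

lemma bij_betw_row_fun:
  "bij_betw row_fun {\<mu>. is_partition \<mu> \<and> sum_list \<mu> = n} (ptns_of n)"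
proof (rule bij_betwI')
  fix \<mu> \<nu> assume "\<mu> \<in> {\<mu>. is_partition \<mu> \<and> sum_list \<mu> = n}" "\<nu> \<in> {\<mu>. is_partition \<mu> \<and> sum_list \<mu> = n}"
  then have p: "is_partition \<mu>" "is_partition \<nu>" by auto
  show "row_fun \<mu> = row_fun \<nu> \<longleftrightarrow> \<mu> = \<nu>"
  proof
    assume eq: "row_fun \<mu> = row_fun \<nu>"
    then have len: "length \<mu> = length \<nu>"
      using row_fun_nonzero[OF p(1)] row_fun_nonzero[OF p(2)] by simp
    moreover have "\<mu> ! i = \<nu> ! i" if "i < length \<mu>" for i
      using fun_cong[OF eq, of i] that len by (simp add: row_fun_def)
    ultimately show "\<mu> = \<nu>" by (rule nth_equalityI)
  qed simp
next
  fix l assume l: "l \<in> ptns_of n"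
  then have l': "l \<in> ptns" by (simp add: ptns_of_def)
  \<comment> \<open>The first empty row, hence the number of parts.\<close>
  define N where "N = (LEAST i. l i = 0)"
  have "l (ptn_size l) = 0" using ptns_zero_beyond[OF l'] by simp
  then have "l N = 0" unfolding N_def by (rule LeastI)
  then have N: "l i = 0" if "N \<le> i" for i
    using ptns_mono[OF l' that] by simp
  have pos: "0 < l i" if "i < N" for i
    using that not_less_Least[of i "\<lambda>i. l i = 0"] by (simp add: N_def)
  define \<mu> where "\<mu> = map l [0..<N]"
  have \<mu>: "row_fun \<mu> = l"
    using N by (auto simp: \<mu>_def row_fun_def fun_eq_iff)
  have "is_partition \<mu>"
    using pos ptns_mono[OF l'] by (auto simp: \<mu>_def is_partition_def sorted_wrt_iff_nth_less)
  with row_fun_ptns[OF this] \<mu> l show "\<exists>\<mu>\<in>{\<mu>. is_partition \<mu> \<and> sum_list \<mu> = n}. l = row_fun \<mu>"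
    by (auto simp: ptns_of_def)
qed (use row_fun_ptns in auto)

lemma cells_row_fun: "cells \<mu> = {(i, j). j < row_fun \<mu> i}"
  by (auto simp: cells_def row_fun_def split: if_splits)

lemma hook_length_row_fun:
  assumes "(i, j) \<in> cells \<mu>"
  shows "hook_length \<mu> (i, j) = hook (row_fun \<mu>) i j"
proof -
  have j: "j < row_fun \<mu> i" using assms by (simp add: cells_row_fun)
  have "{j'. j < j' \<and> (i, j') \<in> cells \<mu>} = {j<..<row_fun \<mu> i}"
    by (auto simp: cells_row_fun)
  with j show ?thesis by (simp add: hook_def cells_row_fun)
qed

lemma b_stat_row_fun:
  assumes "is_partition \<mu>"
  shows "b_stat \<mu> = (\<Sum>i | row_fun \<mu> i \<noteq> 0. i * row_fun \<mu> i)"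
  unfolding row_fun_nonzero[OF assms] b_stat_def by (rule sum.cong) (auto simp: row_fun_def)

lemma principal_schur_row_fun:
  assumes "is_partition \<mu>"
  shows "principal_schur x (row_fun \<mu>) = x ^ b_stat \<mu> / (\<Prod>u\<in>cells \<mu>. 1 - x ^ hook_length \<mu> u)"
proof -
  have "(\<Prod>u\<in>cells \<mu>. 1 - x ^ hook_length \<mu> u) = (\<Prod>(i, j)\<in>cells \<mu>. 1 - x ^ hook (row_fun \<mu>) i j)"
    by (rule prod.cong) (auto simp: hook_length_row_fun simp del: hook_length.simps)
  then show ?thesis
    by (simp add: principal_schur_def b_stat_row_fun[OF assms] cells_row_fun)
qed

lemma one_minus_power_qint: "1 - x ^ n = (1 - x) * qint x n"
  unfolding qint_def by (rule one_diff_power_eq)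

lemma qpoch_qfact: "qpoch x n = (1 - x) ^ n * qfact x n"
  by (simp add: qpoch_def qfact_def one_minus_power_qint prod.distrib)

lemma card_cells: "card (cells \<mu>) = sum_list \<mu>"
proof -
  have "cells \<mu> = Sigma {..<length \<mu>} (\<lambda>i. {..<\<mu> ! i})"
    by (auto simp: cells_def)
  then show ?thesis by (simp add: sum_list_sum_nth atLeast0LessThan)
qed

text \<open>By \<open>principal_schur_in_range\<close> the quotient is a polynomial
  \<open>P\<close>, so the division in \<open>f_poly\<close> is exact. Hooks and
  \<open>qpoch\<close> both contain \<open>1 - qvar\<close> to the power \<open>n\<close>, as there
  are \<open>n\<close> cells. The product form can be transported along ring homomorphisms.\<close>

lemma f_poly_mult_hooks:
  assumes "is_partition \<mu>"
  shows "f_poly \<mu> * (\<Prod>u\<in>cells \<mu>. 1 - qvar ^ hook_length \<mu> u)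
    = qvar ^ b_stat \<mu> * qpoch qvar (sum_list \<mu>)"
proof -
  define n where "n = sum_list \<mu>"
  define H where "H = (\<Prod>u\<in>cells \<mu>. 1 - qvar ^ hook_length \<mu> u)"
  define I where "I = (\<Prod>u\<in>cells \<mu>. qint qvar (hook_length \<mu> u))"
  have HI: "H = (1 - qvar) ^ n * I"
    by (simp add: H_def I_def one_minus_power_qint prod.distrib card_cells n_def)
  have "0 < hook_length \<mu> u" for u
    by (cases u) simp
  then have "1 - qvar ^ hook_length \<mu> u \<noteq> 0" for u
    using qvar_power_neq_1[of "hook_length \<mu> u"] by (metis eq_iff_diff_eq_0)
  then have "H \<noteq> 0"
    using finite_cells by (simp add: H_def)
  then have I: "I \<noteq> 0" and q: "(1 - qvar) ^ n \<noteq> 0"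
    using HI by auto
  have l: "row_fun \<mu> \<in> ptns" "ptn_size (row_fun \<mu>) \<le> n"
    using row_fun_ptns[OF assms] by (auto simp: ptns_of_def n_def)
  obtain P where P: "principal_schur (to_fract qvar) (row_fun \<mu>) * qpoch (to_fract qvar) n = to_fract P"
    using principal_schur_in_range[OF l] by blast
  have "to_fract H = (\<Prod>u\<in>cells \<mu>. 1 - to_fract qvar ^ hook_length \<mu> u)"
    by (simp add: H_def to_fract_hom.hom_prod to_fract_hom.hom_power)
  moreover have "to_fract H \<noteq> 0" using \<open>H \<noteq> 0\<close> by simp
  ultimately have "to_fract (P * H) = to_fract (qvar ^ b_stat \<mu> * qpoch qvar n)"
    using P by (simp add: principal_schur_row_fun[OF assms] to_fract_hom.hom_qpoch to_fract_hom.hom_power divide_simps mult_ac)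
  then have PH: "P * H = qvar ^ b_stat \<mu> * qpoch qvar n"
    by (simp only: to_fract_eq_iff)
  then have "(1 - qvar) ^ n * (P * I) = (1 - qvar) ^ n * (qvar ^ b_stat \<mu> * qfact qvar n)"
    by (simp add: HI qpoch_qfact mult_ac)
  then have "P * I = qvar ^ b_stat \<mu> * qfact qvar n"
    using q by (metis mult_left_cancel)
  then have "f_poly \<mu> = P"
    using I by (simp add: f_poly_def n_def I_def[symmetric]) (metis nonzero_mult_div_cancel_right)
  with PH show ?thesis by (simp add: H_def n_def)
qed

text \<open>Used for two homomorphisms, the constant embedding and the evaluation at
  \<open>fps_X\<close>, which give \<open>f_q\<close> and \<open>f_p\<close>.\<close>

lemma hom_f_poly:
  fixes hom :: "int poly \<Rightarrow> 'a::field"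
  assumes "comm_ring_hom hom" "non_root_of_unity (hom qvar)" "is_partition \<mu>"
  shows "hom (f_poly \<mu>) = principal_schur (hom qvar) (row_fun \<mu>) * qpoch (hom qvar) (sum_list \<mu>)"
proof -
  interpret comm_ring_hom hom by fact
  interpret non_root_of_unity "hom qvar" by fact
  have "0 < hook_length \<mu> u" for u
    by (cases u) simp
  then have "(\<Prod>u\<in>cells \<mu>. 1 - hom qvar ^ hook_length \<mu> u) \<noteq> 0"
    using finite_cells one_minus_power_nonzero by simp
  moreover have "hom (f_poly \<mu>) * (\<Prod>u\<in>cells \<mu>. 1 - hom qvar ^ hook_length \<mu> u)
    = hom qvar ^ b_stat \<mu> * qpoch (hom qvar) (sum_list \<mu>)"
    using arg_cong[OF f_poly_mult_hooks[OF assms(3)], of hom]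
    by (simp add: hom_qpoch hom_power hom_prod hom_minus hom_mult)
  ultimately show ?thesis
    by (simp add: principal_schur_row_fun[OF assms(3)] divide_simps mult_ac)
qed

lemma sum_f_poly:
  fixes hom hom' :: "int poly \<Rightarrow> 'a::field"
  assumes "comm_ring_hom hom" "non_root_of_unity (hom qvar)"
    and "comm_ring_hom hom'" "non_root_of_unity (hom' qvar)"
  shows "(\<Sum>\<mu> | is_partition \<mu> \<and> sum_list \<mu> = k. hom (f_poly \<mu>) * hom' (f_poly \<mu>))
    = cauchy_sum (hom qvar) (hom' qvar) k * (qpoch (hom qvar) k * qpoch (hom' qvar) k)"
proof -
  have "(\<Sum>\<mu> | is_partition \<mu> \<and> sum_list \<mu> = k. hom (f_poly \<mu>) * hom' (f_poly \<mu>))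
    = (\<Sum>\<mu> | is_partition \<mu> \<and> sum_list \<mu> = k. principal_schur (hom qvar) (row_fun \<mu>) *
        principal_schur (hom' qvar) (row_fun \<mu>) * (qpoch (hom qvar) k * qpoch (hom' qvar) k))"
    by (rule sum.cong) (simp_all add: hom_f_poly[OF assms(1,2)] hom_f_poly[OF assms(3,4)] mult_ac)
  also have "\<dots> = (\<Sum>l\<in>ptns_of k. principal_schur (hom qvar) l * principal_schur (hom' qvar) l
      * (qpoch (hom qvar) k * qpoch (hom' qvar) k))"
    by (rule sum.reindex_bij_betw[OF bij_betw_row_fun])
  finally show ?thesis
    by (simp add: cauchy_sum_def sum_distrib_right)
qed

section \<open>Identification of the series in the field of fractions\<close>

lemma comm_ring_hom_to_fract_const: "comm_ring_hom (\<lambda>P::int poly. to_fract (fps_const P))"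
  by unfold_locales (simp_all flip: to_fract_add to_fract_mult)

lemma comm_ring_hom_to_fract_eval:
  "comm_ring_hom (\<lambda>P. to_fract (poly (map_poly of_int P) (a :: 'a::idom)))"
  by unfold_locales (auto simp: of_int_poly_hom.hom_add of_int_poly_hom.hom_mult)

lemma ptns_of_0: "ptns_of 0 = {\<lambda>_. 0}"
proof -
  have "l = (\<lambda>_. 0)" if "l \<in> ptns" "ptn_size l = 0" for l
    using ptns_zero_beyond[OF that(1)] that(2) by auto
  moreover have "(\<lambda>_. 0) \<in> ptns" "ptn_size (\<lambda>_. 0) = 0"
    by (auto simp: ptns_def ptn_size_def antimono_def)
  ultimately show ?thesis unfolding ptns_of_def by blast
qed

text \<open>With the Gaussian binomial written as a quotient, \<open>qpoch q j\<close> cancels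
  against the induction hypothesis. What remains of \<open>IC_parts_recursion\<close> is
  \<open>cauchy_sum_recursion\<close> with its term \<open>j = k\<close> moved to the left.\<close>

lemma IC_parts_eq_cauchy_sum:
  fixes p q :: "int poly fps fract"
  defines "p \<equiv> to_fract fps_X" and "q \<equiv> to_fract (fps_const qvar)"
  shows "to_fract (IC_parts k) = p ^ k * qpoch q k * cauchy_sum p q k"
proof (induction k rule: less_induct)
  case (less k)
  interpret p: non_root_of_unity p
    unfolding p_def by (rule non_root_of_unity_fps_X)
  interpret q: non_root_of_unity q
    unfolding q_def by (rule non_root_of_unity_fps_const_qvar)
  interpret const: comm_ring_hom "\<lambda>P::int poly. to_fract (fps_const P)"
    by (rule comm_ring_hom_to_fract_const)
  show ?case
  proof (cases "k = 0")
    case True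
    then show ?thesis
      by (simp add: IC_parts_0 cauchy_sum_def ptns_of_0 principal_schur_def)
  next
    case False
    have gbin: "to_fract (fps_const (gbin qvar k j)) = qpoch q k / (qpoch q j * qpoch q (k - j))"
      if "j < k" for j
    proof -
      have "to_fract (fps_const (gbin qvar k j)) * (qpoch q j * qpoch q (k - j)) = qpoch q k"
        using arg_cong[OF gbin_qpoch[of j k qvar], of "\<lambda>P. to_fract (fps_const P)"] that
        by (simp only: const.hom_mult const.hom_qpoch q_def less_imp_le)
      then show ?thesis
        using q.qpoch_neq_0 by (simp add: divide_simps)
    qed
    have "(1 - p ^ k) * to_fract (IC_parts k)
      = p ^ k * (\<Sum>j<k. to_fract (fps_const (gbin qvar k j)) * to_fract (IC_parts j))"
      using arg_cong[OF IC_parts_recursion[of k], of to_fract]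
      by (simp add: to_fract_hom.hom_power to_fract_hom.hom_sum p_def)
    also have "(\<Sum>j<k. to_fract (fps_const (gbin qvar k j)) * to_fract (IC_parts j))
      = (\<Sum>j<k. qpoch q k * (p ^ j * cauchy_sum p q j / qpoch q (k - j)))"
      by (rule sum.cong) (use q.qpoch_neq_0 in \<open>simp_all add: gbin less\<close>)
    also have "\<dots> = qpoch q k * ((1 - p ^ k) * cauchy_sum p q k)"
    proof -
      have "cauchy_sum p q k = (\<Sum>j<k. p ^ j * cauchy_sum p q j / qpoch q (k - j)) + p ^ k * cauchy_sum p q k"
        by (subst cauchy_sum_recursion[OF p.non_root_of_unity_axioms q.non_root_of_unity_axioms])
           (simp add: lessThan_Suc_atMost[symmetric])
      then have "(\<Sum>j<k. p ^ j * cauchy_sum p q j / qpoch q (k - j)) = (1 - p ^ k) * cauchy_sum p q k"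
        unfolding left_diff_distrib mult_1_left eq_diff_eq by (rule sym)
      then show ?thesis
        by (simp only: sum_distrib_left[symmetric])
    qed
    finally have "(1 - p ^ k) * to_fract (IC_parts k) = (1 - p ^ k) * (p ^ k * qpoch q k * cauchy_sum p q k)"
      by (simp add: mult_ac)
    then show ?thesis
      using p.one_minus_power_nonzero[of k] False by (metis mult_left_cancel neq0_conv)
  qed
qed

text \<open>Multiplied by \<open>qpoch fps_X k\<close>, the identity has no denominators and
  descends from the field of fractions by injectivity of \<open>to_fract\<close>.\<close>

lemma IC_parts_eq_sum_partitions:
  "IC_parts k = fps_X ^ k * recip (qpoch fps_X k) *
     (\<Sum>\<mu> | is_partition \<mu> \<and> sum_list \<mu> = k. f_p \<mu> * f_q \<mu>)"
proof -
  define p q :: "int poly fps fract" where "p = to_fract fps_X" and "q = to_fract (fps_const qvar)"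
  define F where "F = (\<Sum>\<mu> | is_partition \<mu> \<and> sum_list \<mu> = k. f_p \<mu> * f_q \<mu>)"
  have hp: "to_fract (poly (map_poly of_int qvar) fps_X) = p"
    by (simp add: p_def map_poly_pCons)
  have "to_fract F = cauchy_sum p q k * (qpoch p k * qpoch q k)"
    using sum_f_poly[OF comm_ring_hom_to_fract_eval[of "fps_X :: int poly fps"] _ comm_ring_hom_to_fract_const, of k]
      non_root_of_unity_fps_X non_root_of_unity_fps_const_qvar
    unfolding hp F_def by (simp add: to_fract_hom.hom_sum f_p_def f_q_def p_def q_def)
  then have "to_fract (qpoch fps_X k * IC_parts k) = to_fract (fps_X ^ k * F)"
    by (simp add: IC_parts_eq_cauchy_sum to_fract_hom.hom_qpoch to_fract_hom.hom_power p_def q_def mult_ac)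
  then have "qpoch fps_X k * IC_parts k = fps_X ^ k * F"
    by (simp only: to_fract_eq_iff)
  then have "recip (qpoch fps_X k) * qpoch fps_X k * IC_parts k = fps_X ^ k * recip (qpoch fps_X k) * F"
    by (simp add: mult_ac)
  then show ?thesis
    by (simp add: recip_qpoch F_def)
qed

text \<open>Agreement of the coefficients below \<open>N\<close> means distance at most
  \<open>(1 / 2) ^ N\<close>. Since \<open>s a\<close> bounds the order of \<open>t a\<close> from
  below, the finite set \<open>B\<close> already determines these coefficients.\<close>

lemma has_sum_fps:
  fixes t :: "'b \<Rightarrow> 'a::comm_ring_1 fps"
  assumes fin: "\<And>n. finite {a \<in> A. s a \<le> n}"
    and zero: "\<And>a n. a \<in> A \<Longrightarrow> n < s a \<Longrightarrow> fps_nth (t a) n = 0"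
    and nth: "\<And>n. fps_nth F n = (\<Sum>a | a \<in> A \<and> s a \<le> n. fps_nth (t a) n)"
  shows "(t has_sum F) A"
  unfolding has_sum_def tendsto_iff eventually_finite_subsets_at_top
proof (intro allI impI)
  fix e :: real assume "0 < e"
  then obtain N where N: "(1 / 2) ^ N < e"
    using real_arch_pow_inv[of e "1 / 2"] by auto
  define B where "B = {a \<in> A. s a \<le> N}"
  have "dist (sum t Y) F < e" if Y: "finite Y" "B \<subseteq> Y" "Y \<subseteq> A" for Y
  proof (cases "sum t Y = F")
    case False
    have "fps_nth (sum t Y - F) n = 0" if "n < N" for n
    proof -
      have "fps_nth (sum t Y) n = (\<Sum>a\<in>Y. fps_nth (t a) n)"
        by (simp add: fps_sum_nth)
      also have "\<dots> = (\<Sum>a | a \<in> A \<and> s a \<le> n. fps_nth (t a) n)"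
      proof (rule sum.mono_neutral_right)
        show "\<forall>a\<in>Y - {a \<in> A. s a \<le> n}. fps_nth (t a) n = 0"
        proof
          fix a assume "a \<in> Y - {a \<in> A. s a \<le> n}"
          with Y(3) have "a \<in> A" "n < s a" by auto
          then show "fps_nth (t a) n = 0" by (rule zero)
        qed
      qed (use Y that in \<open>auto simp: B_def\<close>)
      finally show ?thesis by (simp add: nth)
    qed
    then have "N \<le> subdegree (sum t Y - F)"
      using False by (intro subdegree_geI) auto
    then have "dist (sum t Y) F \<le> (1 / 2) ^ N"
      using False by (simp add: dist_fps_def power_one_over divide_simps)
    with N show ?thesis by simp
  qed (use \<open>0 < e\<close> in simp)
  then show "\<exists>X. finite X \<and> X \<subseteq> A \<and> (\<forall>Y. finite Y \<and> X \<subseteq> Y \<and> Y \<subseteq> A \<longrightarrow> dist (sum t Y) F < e)"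
    using fin[of N] by (intro exI[of _ B]) (auto simp: B_def)
qed

lemma finite_partitions_le: "finite {\<mu>. is_partition \<mu> \<and> sum_list \<mu> \<le> n}"
proof -
  have "{\<mu>. is_partition \<mu> \<and> sum_list \<mu> \<le> n} = (\<Union>k\<le>n. {\<mu>. is_partition \<mu> \<and> sum_list \<mu> = k})"
    by auto
  then show ?thesis by (simp add: finite_partitions)
qed

text \<open>The factor \<open>fps_X ^ sum_list \<mu>\<close> gives the order bound, and grouping by
  size turns each coefficient into \<open>fps_nth_IC\<close>.\<close>

lemma IC_has_sum:
  "((\<lambda>\<mu>. fps_X ^ sum_list \<mu> * recip (qpoch fps_X (sum_list \<mu>)) * f_p \<mu> * f_q \<mu>) has_sum IC)
     {\<mu>. is_partition \<mu>}"
proof (rule has_sum_fps[where s = sum_list])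
  define t where "t = (\<lambda>\<mu>. fps_X ^ sum_list \<mu> * recip (qpoch fps_X (sum_list \<mu>)) * f_p \<mu> * f_q \<mu>)"
  show "finite {\<mu> \<in> {\<mu>. is_partition \<mu>}. sum_list \<mu> \<le> n}" for n
    using finite_partitions_le by simp
  show "fps_nth (fps_X ^ sum_list \<mu> * recip (qpoch fps_X (sum_list \<mu>)) * f_p \<mu> * f_q \<mu>) n = 0"
    if "n < sum_list \<mu>" for \<mu> n
    using that by (simp add: mult.assoc fps_X_power_mult_nth)
  have IC_parts: "IC_parts k = (\<Sum>\<mu> | is_partition \<mu> \<and> sum_list \<mu> = k. t \<mu>)" for k
    unfolding IC_parts_eq_sum_partitions sum_distrib_left
    by (rule sum.cong) (auto simp: t_def mult.assoc)
  show "fps_nth IC n = (\<Sum>\<mu> | \<mu> \<in> {\<mu>. is_partition \<mu>} \<and> sum_list \<mu> \<le> n.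
      fps_nth (fps_X ^ sum_list \<mu> * recip (qpoch fps_X (sum_list \<mu>)) * f_p \<mu> * f_q \<mu>) n)" for n
  proof -
    define S where "S = {\<mu>. is_partition \<mu> \<and> sum_list \<mu> \<le> n}"
    have "(\<Sum>\<mu>\<in>S. fps_nth (t \<mu>) n) = (\<Sum>k\<le>n. \<Sum>\<mu> | \<mu> \<in> S \<and> sum_list \<mu> = k. fps_nth (t \<mu>) n)"
      by (rule sum.group[symmetric]) (use finite_partitions_le in \<open>auto simp: S_def\<close>)
    also have "\<dots> = fps_nth IC n"
      unfolding fps_nth_IC IC_parts fps_sum_nth by (auto simp: S_def intro!: sum.cong)
    finally show ?thesis by (simp add: S_def t_def)
  qed
qed

theorem corollary11:
  shows "(\<forall>k. IC_parts k =
            fps_X ^ k * recip (qpoch fps_X k) *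
            (\<Sum>\<mu> | is_partition \<mu> \<and> sum_list \<mu> = k. f_p \<mu> * f_q \<mu>)) \<and>
         ((\<lambda>\<mu>. fps_X ^ sum_list \<mu> * recip (qpoch fps_X (sum_list \<mu>)) * f_p \<mu> * f_q \<mu>)
            has_sum IC) {\<mu>. is_partition \<mu>} \<and>
         IC_parts 0 = 1 \<and>
         (\<forall>k\<ge>1. IC_parts k =
            fps_X ^ k * recip (1 - fps_X ^ k) *
            (\<Sum>j=0..k - 1. fps_const (gauss_binomial k j) * IC_parts j))"
proof (intro conjI allI impI)
  fix k :: nat assume k: "1 \<le> k"
  have "recip (1 - fps_X ^ k) * (1 - fps_X ^ k) = (1 :: int poly fps)"
    by (rule recip_mult) (use k in \<open>simp add: fps_X_power_nth\<close>)
  then have "IC_parts k = recip (1 - fps_X ^ k) * ((1 - fps_X ^ k) * IC_parts k)"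
    by (simp only: mult.assoc[symmetric] mult_1_left)
  also have "\<dots> = fps_X ^ k * recip (1 - fps_X ^ k) * (\<Sum>j<k. fps_const (gbin qvar k j) * IC_parts j)"
    by (subst IC_parts_recursion) (simp only: mult_ac)
  also have "(\<Sum>j<k. fps_const (gbin qvar k j) * IC_parts j)
    = (\<Sum>j = 0..k - 1. fps_const (gauss_binomial k j) * IC_parts j)"
    by (rule sum.cong) (use k in \<open>auto simp: gauss_binomial_eq_gbin\<close>)
  finally show "IC_parts k = fps_X ^ k * recip (1 - fps_X ^ k) *
      (\<Sum>j=0..k - 1. fps_const (gauss_binomial k j) * IC_parts j)" .
qed (fact IC_parts_eq_sum_partitions IC_has_sum IC_parts_0)+

end
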